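(* Let $d\ge2$. (i) Let $0<p<\infty$ and $0<q\le\infty$. If $S^0_{p,q}B(\mathbb{R}^d)\hookrightarrow B^0_{p,q}(\mathbb{R}^d)$, then $q\le\min(2,p)$. (ii) Let $0<q\le\infty$. If $S^0_{\infty,q}B(\mathbb{R}^d)\hookrightarrow B^0_{\infty,q}(\mathbb{R}^d)$, then $q\le1$.
   Context: Isotropic Besov spaces: let $\psi_0\in C_0^\infty(\mathbb{R}^d)$ with $\psi_0(x)=1$ if $\max_i|x_i|\le1$ and $\psi_0(x)=0$ if $\max_i|x_i|\ge 3/2$, and $\psi_j(x)=\psi_0(2^{-j}x)-\psi_0(2^{-j+1}x)$, $j\in\mathbb{N}$. For $s\in\mathbb{R}$, $0<p,q\le\infty$, $B^s_{p,q}(\mathbb{R}^d)$ is the set of tempered distributions $f$ with $\big(\sum_{j\ge0}2^{jsq}\|\mathcal{F}^{-1}[\psi_j\mathcal{F}f]\|_{L_p}^q\big)^{1/q}<\infty$ (modification if $q=\infty$), $\mathcal{F}$ the Fourier transform. Dominating mixed spaces: let $\varphi_0\in C_0^\infty(\mathbb{R})$ with $\varphi_0=1$ on $[-1,1]$, $\operatorname{supp}\varphi_0\subset[-3/2,3/2]$, $\varphi_j(s)=\varphi_0(2^{-j}s)-\varphi_0(2^{-j+1}s)$, and $\varphi_{\bar k}(x)=\prod_{i=1}^d\varphi_{k_i}(x_i)$, $|\bar k|=k_1+\dots+k_d$. $S^s_{p,q}B(\mathbb{R}^d)$ is the set of tempered distributions $f$ with $\big(\sum_{\bar k\in\mathbb{N}_0^d}2^{|\bar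 k|sq}\|\mathcal{F}^{-1}[\varphi_{\bar k}\mathcal{F}f]\|_{L_p}^q\big)^{1/q}<\infty$. $\hookrightarrow$ is a continuous embedding. *)

theory Defs
  imports "HOL-Analysis.Analysis" "HOL-Probability.Essential_Supremum"
begin

fun dpart :: "'n::finite list \<Rightarrow> (real^'n \<Rightarrow> 'a::real_normed_vector) \<Rightarrow> real^'n \<Rightarrow> 'a" where
  "dpart [] g = g"
| "dpart (i # is) g = (\<lambda>x. frechet_derivative (dpart is g) (at x) (axis i 1))"

definition smooth_fun :: "(real^'n::finite \<Rightarrow> 'a::real_normed_vector) \<Rightarrow> bool" where
  "smooth_fun g \<longleftrightarrow> (\<forall>is x. dpart is g differentiable (at x))"

definition schwartz :: "(real^'n::finite \<Rightarrow> complex) \<Rightarrow> bool" where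
  "schwartz g \<longleftrightarrow> smooth_fun g \<and>
     (\<forall>is (N::nat). \<exists>C. \<forall>x. (1 + norm x) ^ N * norm (dpart is g x) \<le> C)"

definition sch_seminorm :: "nat \<Rightarrow> 'n::finite list \<Rightarrow> (real^'n \<Rightarrow> complex) \<Rightarrow> real" where
  "sch_seminorm N is g = (SUP x. (1 + norm x) ^ N * norm (dpart is g x))"

text \<open>Tempered distributions: continuous linear functionals on the Schwartz space
  (values of T outside the Schwartz space are irrelevant).\<close>
definition tempered :: "((real^'n::finite \<Rightarrow> complex) \<Rightarrow> complex) \<Rightarrow> bool" where
  "tempered T \<longleftrightarrow>
     (\<forall>f g a b. schwartz f \<longrightarrow> schwartz g \<longrightarrow>
        T (\<lambda>x. a * f x + b * g x) = a * T f + b * T g) \<and>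
     (\<exists>C N M. \<forall>g. schwartz g \<longrightarrow>
        norm (T g) \<le> C * (\<Sum>is\<in>{is::'n list. length is \<le> M}. sch_seminorm N is g))"

text \<open>With F g(\<xi>) = (2\<pi>)^{-d/2} \<integral> g(x) e^{-ix\<xi>} dx one has
  F^{-1}[\<chi> F T](x) = T(y \<mapsto> K_\<chi>(x - y)), K_\<chi>(z) = (2\<pi>)^{-d} \<integral> \<chi>(\<xi>) e^{iz\<xi>} d\<xi>.\<close>
definition mkernel :: "(real^'n::finite \<Rightarrow> real) \<Rightarrow> real^'n \<Rightarrow> complex" where
  "mkernel c z = complex_of_real (1 / (2 * pi) ^ CARD('n)) *
      (LINT \<xi>|lborel. complex_of_real (c \<xi>) * cis (z \<bullet> \<xi>))"

definition fmult :: "(real^'n::finite \<Rightarrow> real) \<Rightarrow> ((real^'n \<Rightarrow> complex) \<Rightarrow> complex)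
                      \<Rightarrow> real^'n \<Rightarrow> complex" where
  "fmult c T x = T (\<lambda>y. mkernel c (x - y))"

definition epow :: "ennreal \<Rightarrow> real \<Rightarrow> ennreal" where
  "epow x r = (if x = top then top else ennreal (enn2real x powr r))"

definition Lp_norm :: "ennreal \<Rightarrow> (real^'n::finite \<Rightarrow> complex) \<Rightarrow> ennreal" where
  "Lp_norm p g =
    (if p = top then e2ennreal (esssup lborel (\<lambda>x. ereal (norm (g x))))
     else epow (\<integral>\<^sup>+ x. ennreal (norm (g x) powr enn2real p) \<partial>lborel) (1 / enn2real p))"

definition lq_norm :: "ennreal \<Rightarrow> ('i \<Rightarrow> ennreal) \<Rightarrow> ennreal" where
  "lq_norm q a =
    (if q = top then (SUP i. a i)
     else epow (\<integral>\<^sup>+ i. epow (a i) (enn2real q) \<partial>count_space UNIV) (1 / enn2real q))"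

definition maxnorm :: "real^'n::finite \<Rightarrow> real" where
  "maxnorm x = Max (range (\<lambda>i. \<bar>x $ i\<bar>))"

definition psi0_admissible :: "(real^'n::finite \<Rightarrow> real) \<Rightarrow> bool" where
  "psi0_admissible \<psi>0 \<longleftrightarrow> smooth_fun \<psi>0 \<and>
     (\<forall>x. maxnorm x \<le> 1 \<longrightarrow> \<psi>0 x = 1) \<and> (\<forall>x. maxnorm x \<ge> 3/2 \<longrightarrow> \<psi>0 x = 0)"

definition psi_j :: "(real^'n::finite \<Rightarrow> real) \<Rightarrow> nat \<Rightarrow> real^'n \<Rightarrow> real" where
  "psi_j \<psi>0 j x = (if j = 0 then \<psi>0 x
     else \<psi>0 ((1 / 2 ^ j) *\<^sub>R x) - \<psi>0 ((2 / 2 ^ j) *\<^sub>R x))"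

definition besov_norm :: "(real^'n::finite \<Rightarrow> real) \<Rightarrow> real \<Rightarrow> ennreal \<Rightarrow> ennreal
                           \<Rightarrow> ((real^'n \<Rightarrow> complex) \<Rightarrow> complex) \<Rightarrow> ennreal" where
  "besov_norm \<psi>0 s p q T =
     lq_norm q (\<lambda>j::nat. ennreal (2 powr (real j * s)) * Lp_norm p (fmult (psi_j \<psi>0 j) T))"

definition phi0_admissible :: "(real \<Rightarrow> real) \<Rightarrow> bool" where
  "phi0_admissible \<phi>0 \<longleftrightarrow> (\<forall>k x. (deriv ^^ k) \<phi>0 differentiable (at x)) \<and>
     (\<forall>t. \<bar>t\<bar> \<le> 1 \<longrightarrow> \<phi>0 t = 1) \<and> (\<forall>t. \<bar>t\<bar> > 3/2 \<longrightarrow> \<phi>0 t = 0)"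

definition phi_j :: "(real \<Rightarrow> real) \<Rightarrow> nat \<Rightarrow> real \<Rightarrow> real" where
  "phi_j \<phi>0 j t = (if j = 0 then \<phi>0 t else \<phi>0 (t / 2 ^ j) - \<phi>0 (2 * t / 2 ^ j))"

definition phi_k :: "(real \<Rightarrow> real) \<Rightarrow> ('n::finite \<Rightarrow> nat) \<Rightarrow> real^'n \<Rightarrow> real" where
  "phi_k \<phi>0 k x = (\<Prod>i\<in>UNIV. phi_j \<phi>0 (k i) (x $ i))"

definition mixed_norm :: "(real \<Rightarrow> real) \<Rightarrow> real \<Rightarrow> ennreal \<Rightarrow> ennreal
                           \<Rightarrow> ((real^'n::finite \<Rightarrow> complex) \<Rightarrow> complex) \<Rightarrow> ennreal" where
  "mixed_norm \<phi>0 s p q T =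
     lq_norm q (\<lambda>k::'n \<Rightarrow> nat. ennreal (2 powr (real (sum k UNIV) * s))
                                 * Lp_norm p (fmult (phi_k \<phi>0 k) T))"

definition mixed_embeds_besov :: "(real \<Rightarrow> real) \<Rightarrow> (real^'n::finite \<Rightarrow> real)
                                   \<Rightarrow> real \<Rightarrow> ennreal \<Rightarrow> ennreal \<Rightarrow> bool" where
  "mixed_embeds_besov \<phi>0 \<psi>0 s p q \<longleftrightarrow>
     (\<exists>C::real. \<forall>T::(real^'n \<Rightarrow> complex) \<Rightarrow> complex.
        tempered T \<and> mixed_norm \<phi>0 s p q T < top \<longrightarrow>
        besov_norm \<psi>0 s p q T \<le> ennreal C * mixed_norm \<phi>0 s p q T)"

end

theory Submission
  imports Defs "HOL-Probability.Characteristic_Functions" "HOL-Probability.Sinc_Integral"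
    "HOL-Real_Asymp.Real_Asymp"
begin

text \<open>
  Testing the embedding on one isotropic block suffices. Let \<open>g\<close> be a power of the cardinal sine
  whose Fourier transform lives in \<open>[-1, 1]\<close>. In one coordinate take the fixed frequency
  \<open>7 * 2 ^ N\<close>, in a second one the frequencies \<open>7 * 2 ^ l\<close> for \<open>1 \<le> l \<le> N\<close>, and modulate (and
  possibly translate in the second coordinate) tensor powers of \<open>g\<close> accordingly. The \<open>N\<close> resulting
  wave packets occupy \<open>N\<close> different dyadic boxes but a single dyadic annulus, so the embedding bounds
  the \<open>L_p\<close> norm of their sum by a multiple of \<open>N ^ (1 / q)\<close>.

  Without translations the sum is a lacunary trigonometric polynomial times \<open>g\<close>; its \<open>L_p\<close> norm is
  at least of order \<open>N ^ (1 / 2)\<close> for finite \<open>p\<close> (compare the second and the fourth moment), and its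
  value at the origin is \<open>N\<close>. This gives \<open>q \<le> 2\<close>, and \<open>q \<le> 1\<close> when \<open>p\<close> is infinite. With
  translations that are far apart the packets are almost disjoint, so the norm is of order
  \<open>N ^ (1 / p)\<close>, whence \<open>q \<le> p\<close>.

  The test distributions are integrable functions, so multiplying their Fourier transform by \<open>c\<close>
  only needs Fubini's theorem and Fourier inversion for the explicit one-dimensional packets,
  never the decay of the kernel of \<open>c\<close>.
\<close>

section \<open>Fourier inversion on the line\<close>

text \<open>The kernels in mind are characters \<open>cis\<close>: having modulus at most 1, they
  leave \<open>f x * c y\<close> as an integrable majorant on the product space. Continuity of
  \<open>k\<close> supplies the joint measurability.\<close>

lemma Fubini_bounded_kernel:
  fixes f :: "'a::euclidean_space \<Rightarrow> complex" and c :: "'b::euclidean_space \<Rightarrow> complex"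
    and k :: "'a \<Rightarrow> 'b \<Rightarrow> complex"
  assumes f: "integrable lborel f" and c: "integrable lborel c"
    and k: "continuous_on UNIV (\<lambda>z. k (fst z) (snd z))"
    and le: "\<And>x y. norm (k x y) \<le> 1"
  shows "integrable lborel (\<lambda>x. f x * (LINT y|lborel. c y * k x y))"
    and "(LINT x|lborel. f x * (LINT y|lborel. c y * k x y))
        = (LINT y|lborel. c y * (LINT x|lborel. f x * k x y))"
proof -
  let ?h = "\<lambda>(x, y). f x * (c y * k x y)"
  have [measurable]: "f \<in> borel_measurable borel" "c \<in> borel_measurable borel"
    using f c by auto
  have "(\<lambda>z. k (fst z) (snd z)) \<in> borel_measurable (borel \<Otimes>\<^sub>M borel)"
    unfolding borel_prod by (rule borel_measurable_continuous_onI[OF k])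
  then have [measurable]: "(\<lambda>(x, y). k x y) \<in> borel_measurable (borel \<Otimes>\<^sub>M borel)"
    by (simp add: case_prod_beta')
  have h: "integrable (lborel \<Otimes>\<^sub>M lborel) ?h"
  proof (rule lborel_pair.Fubini_integrable)
    have b: "integrable lborel (\<lambda>x. norm (f x) * (LINT y|lborel. norm (c y)))"
      using f by auto
    have ck: "integrable lborel (\<lambda>y. norm (c y * k x y))" for x
      by (rule Bochner_Integration.integrable_bound[OF c])
        (auto simp: norm_mult intro!: mult_left_le le)
    show "integrable lborel (\<lambda>x. LINT y|lborel. norm (?h (x, y)))"
    proof (rule Bochner_Integration.integrable_bound[OF b])
      have "(LINT y|lborel. norm (c y * k x y)) \<le> (LINT y|lborel. norm (c y))" for x
        by (rule integral_mono[OF ck]) (use c in \<open>auto simp: norm_mult intro!: mult_left_le le\<close>)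
      then show "AE x in lborel. norm (LINT y|lborel. norm (?h (x, y)))
          \<le> norm (norm (f x) * (LINT y|lborel. norm (c y)))"
        by (auto simp: norm_mult abs_mult intro!: mult_left_mono)
    qed (simp add: norm_mult)
    show "AE x in lborel. integrable lborel (\<lambda>y. ?h (x, y))"
      using ck by (auto intro!: integrable_norm_cancel[OF ck] integrable_mult_right)
  qed measurable
  from lborel_pair.integrable_fst[OF h]
  show "integrable lborel (\<lambda>x. f x * (LINT y|lborel. c y * k x y))"
    by simp
  from lborel_pair.Fubini_integral[of "\<lambda>x y. f x * (c y * k x y)"] h
  have "(LINT y|lborel. LINT x|lborel. f x * (c y * k x y)) = (LINT x|lborel. LINT y|lborel. f x * (c y * k x y))"
    by simp
  moreover have "(LINT y|lborel. LINT x|lborel. f x * (c y * k x y))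
      = (LINT y|lborel. LINT x|lborel. c y * (f x * k x y))"
    by (intro Bochner_Integration.integral_cong refl) simp
  ultimately show "(LINT x|lborel. f x * (LINT y|lborel. c y * k x y))
        = (LINT y|lborel. c y * (LINT x|lborel. f x * k x y))"
    by (simp only: integral_mult_right_zero)
qed

lemma measurable_cis[measurable]: "cis \<in> borel_measurable borel"
  by (intro borel_measurable_continuous_onI continuous_intros)

text \<open>This is the characteristic function of the standard normal distribution, rescaled by the
  substitution \<open>x = e * y\<close>.\<close>

lemma integral_gaussian_cis:
  fixes e s :: real
  assumes "0 < e"
  shows "integrable lborel (\<lambda>y. complex_of_real (exp (- (e * y)\<^sup>2 / 2)) * cis (y * s))"
    and "(LINT y|lborel. complex_of_real (exp (- (e * y)\<^sup>2 / 2)) * cis (y * s))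
      = complex_of_real (sqrt (2 * pi) / e * exp (- s\<^sup>2 / (2 * e\<^sup>2)))"
proof -
  let ?g = "\<lambda>x. complex_of_real (exp (- x\<^sup>2 / 2)) * cis (x * (s / e))"
  have i0: "integrable lborel (\<lambda>x. exp (- x\<^sup>2 / 2) :: real)"
    using integrable_mult_right[of "sqrt (2 * pi)", OF integrable_normal_density[of 1 0]]
    by (simp add: normal_density_def)
  have i1: "integrable lborel ?g"
    by (rule Bochner_Integration.integrable_bound[OF i0]) (auto simp: norm_mult)
  have "char std_normal_distribution (s / e) = (LINT x|lborel. std_normal_density x *\<^sub>R cis ((s / e) * x))"
    unfolding char_def by (subst integral_density) (auto simp: cis_conv_exp)
  also have "\<dots> = (LINT x|lborel. complex_of_real (1 / sqrt (2 * pi)) * ?g x)"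
    by (rule Bochner_Integration.integral_cong)
      (auto simp: normal_density_def scaleR_conv_of_real mult_ac)
  also have "\<dots> = complex_of_real (1 / sqrt (2 * pi)) * (LINT x|lborel. ?g x)"
    by simp
  finally have "(LINT x|lborel. ?g x) = complex_of_real (sqrt (2 * pi) * exp (- (s / e)\<^sup>2 / 2))"
    unfolding char_std_normal_distribution by (simp add: field_simps)
  moreover have "(LINT x|lborel. ?g x) = \<bar>e\<bar> *\<^sub>R (LINT y|lborel. ?g (0 + e * y))"
    by (rule lborel_integral_real_affine) (use assms in auto)
  ultimately have "\<bar>e\<bar> *\<^sub>R (LINT y|lborel. ?g (0 + e * y)) = complex_of_real (sqrt (2 * pi) * exp (- (s / e)\<^sup>2 / 2))"
    by simp
  moreover have "?g (0 + e * y) = complex_of_real (exp (- (e * y)\<^sup>2 / 2)) * cis (y * s)" for y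
    using assms by simp
  ultimately show "(LINT y|lborel. complex_of_real (exp (- (e * y)\<^sup>2 / 2)) * cis (y * s))
      = complex_of_real (sqrt (2 * pi) / e * exp (- s\<^sup>2 / (2 * e\<^sup>2)))"
    using assms by (simp add: scaleR_conv_of_real field_simps power_divide)
  have "integrable lborel (\<lambda>y. ?g (0 + e * y))"
    using lborel_integrable_real_affine[OF i1, of e 0] assms by simp
  then show "integrable lborel (\<lambda>y. complex_of_real (exp (- (e * y)\<^sup>2 / 2)) * cis (y * s))"
    using assms by simp
qed

text \<open>Carries no factor \<open>2 * pi\<close>; the whole constant appears in the inversion
  formula and cancels against the one in \<open>mkernel\<close>.\<close>

definition fourier :: "(real \<Rightarrow> complex) \<Rightarrow> real \<Rightarrow> complex" where
  "fourier v \<zeta> = (LINT t|lborel. v t * cis (- (\<zeta> * t)))"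

lemma integrable_mult_cis:
  assumes "integrable M v" "w \<in> borel_measurable M"
  shows "integrable M (\<lambda>t. v t * cis (w t))"
proof (rule Bochner_Integration.integrable_bound[OF assms(1)])
  show "(\<lambda>t. v t * cis (w t)) \<in> borel_measurable M"
    using assms by measurable
qed (auto simp: norm_mult)

lemma norm_fourier_le:
  assumes "integrable lborel v"
  shows "norm (fourier v \<zeta>) \<le> (LINT t|lborel. norm (v t))"
proof -
  have "norm (fourier v \<zeta>) \<le> (LINT t|lborel. norm (v t * cis (- (\<zeta> * t))))"
    unfolding fourier_def by (rule integral_norm_bound)
  then show ?thesis by (simp add: norm_mult)
qed

lemma measurable_fourier:
  assumes [measurable]: "v \<in> borel_measurable borel"
  shows "fourier v \<in> borel_measurable borel"
  unfolding fourier_def by measurable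

text \<open>On the band the transform is bounded by the L_1 norm of \<open>v\<close>, and the band
  has finite length.\<close>

lemma integrable_fourier_band_limited:
  assumes v: "integrable lborel v" and supp: "\<And>\<zeta>. \<zeta> \<notin> {a..b} \<Longrightarrow> fourier v \<zeta> = 0"
  shows "integrable lborel (fourier v)"
proof (rule Bochner_Integration.integrable_bound)
  show "integrable lborel (\<lambda>\<zeta>. indicator {a..b} \<zeta> * (LINT t|lborel. norm (v t)))"
    by (auto intro!: integrable_real_indicator simp: emeasure_lborel_Icc_eq)
  show "fourier v \<in> borel_measurable lborel"
    using measurable_fourier v by auto
  show "AE \<zeta> in lborel. norm (fourier v \<zeta>) \<le> norm (indicator {a..b} \<zeta> * (LINT t|lborel. norm (v t)))"
    using supp norm_fourier_le[OF v] by (auto simp: indicator_def)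
qed

text \<open>Insert a Gaussian factor of width \<open>1 / e n\<close>. By Fubini the regularised
  integral is a Gaussian mean of \<open>v\<close> at scale \<open>e n\<close> around
  \<open>x\<close>; dominated convergence is then applied to both expressions as \<open>e n\<close>
  tends to 0.\<close>

lemma fourier_inversion:
  assumes v: "integrable lborel v" and cont: "continuous_on UNIV v"
    and bd: "\<And>t. norm (v t) \<le> B" and Fv: "integrable lborel (fourier v)"
  shows "(LINT \<zeta>|lborel. fourier v \<zeta> * cis (x * \<zeta>)) = complex_of_real (2 * pi) * v x"
proof -
  define e where "e n = 1 / real (Suc n)" for n
  have e: "0 < e n" for n by (simp add: e_def)
  have e0: "e \<longlonglongrightarrow> 0"
    unfolding e_def by (rule LIMSEQ_inverse_real_of_nat[unfolded inverse_eq_divide])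
  have [measurable]: "v \<in> borel_measurable borel" "fourier v \<in> borel_measurable borel"
    using v measurable_fourier by auto
  let ?I = "\<lambda>n. LINT \<zeta>|lborel. fourier v \<zeta> * cis (x * \<zeta>) * complex_of_real (exp (- (e n * \<zeta>)\<^sup>2 / 2))"
  let ?G = "\<lambda>u::real. complex_of_real (exp (- u\<^sup>2 / 2))"
  have iG: "integrable lborel ?G" and IG: "(LINT u|lborel. ?G u) = complex_of_real (sqrt (2 * pi))"
    using integral_gaussian_cis[of 1 0] by auto
  have lim1: "?I \<longlonglongrightarrow> (LINT \<zeta>|lborel. fourier v \<zeta> * cis (x * \<zeta>))"
  proof (rule integral_dominated_convergence[where w="\<lambda>\<zeta>. norm (fourier v \<zeta>)"])
    show "AE \<zeta> in lborel. (\<lambda>n. fourier v \<zeta> * cis (x * \<zeta>) * complex_of_real (exp (- (e n * \<zeta>)\<^sup>2 / 2)))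
        \<longlonglongrightarrow> fourier v \<zeta> * cis (x * \<zeta>)"
    proof (rule AE_I2)
      fix \<zeta> :: real
      have "(\<lambda>n. fourier v \<zeta> * cis (x * \<zeta>) * complex_of_real (exp (- (e n * \<zeta>)\<^sup>2 / 2)))
        \<longlonglongrightarrow> fourier v \<zeta> * cis (x * \<zeta>) * complex_of_real (exp (- (0 * \<zeta>)\<^sup>2 / 2))"
        by (intro tendsto_intros e0) auto
      then show "(\<lambda>n. fourier v \<zeta> * cis (x * \<zeta>) * complex_of_real (exp (- (e n * \<zeta>)\<^sup>2 / 2)))
        \<longlonglongrightarrow> fourier v \<zeta> * cis (x * \<zeta>)" by simp
    qed
  qed (use Fv in \<open>auto simp: norm_mult mult_left_le\<close>)
  \<comment> \<open>After Fubini and the inner Gaussian integral, substituting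
    \<open>t = x + e n * u\<close> moves the dependence on \<open>n\<close> out of the Gaussian and
    into the argument of \<open>v\<close>.\<close>
  have eq: "?I n = (LINT u|lborel. complex_of_real (sqrt (2 * pi)) * (v (x + e n * u) * ?G u))" for n
  proof -
    let ?c = "\<lambda>\<zeta>. complex_of_real (exp (- (e n * \<zeta>)\<^sup>2 / 2)) * cis (\<zeta> * x)"
    have c: "integrable lborel ?c" using integral_gaussian_cis[OF e] by blast
    have "?I n = (LINT \<zeta>|lborel. ?c \<zeta> * (LINT t|lborel. v t * cis (- (\<zeta> * t))))"
      by (rule Bochner_Integration.integral_cong) (auto simp: fourier_def mult_ac)
    also have "\<dots> = (LINT t|lborel. v t * (LINT \<zeta>|lborel. ?c \<zeta> * cis (- (\<zeta> * t))))"
      by (rule Fubini_bounded_kernel(2)[OF c v, where k="\<lambda>\<zeta> t. cis (- (\<zeta> * t))"]) (auto intro!: continuous_intros)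
    also have "\<dots> = (LINT t|lborel. v t * complex_of_real (sqrt (2 * pi) / e n * exp (- (x - t)\<^sup>2 / (2 * (e n)\<^sup>2))))"
    proof (rule Bochner_Integration.integral_cong[OF refl])
      fix t
      have "?c \<zeta> * cis (- (\<zeta> * t)) = complex_of_real (exp (- (e n * \<zeta>)\<^sup>2 / 2)) * cis (\<zeta> * (x - t))" for \<zeta>
        by (simp add: mult.assoc cis_mult right_diff_distrib)
      then show "v t * (LINT \<zeta>|lborel. ?c \<zeta> * cis (- (\<zeta> * t)))
          = v t * complex_of_real (sqrt (2 * pi) / e n * exp (- (x - t)\<^sup>2 / (2 * (e n)\<^sup>2)))"
        using integral_gaussian_cis(2)[OF e, of n "x - t"] by (simp only:)
    qed
    also have "\<dots> = \<bar>e n\<bar> *\<^sub>R (LINT u|lborel. v (x + e n * u) *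
        complex_of_real (sqrt (2 * pi) / e n * exp (- (x - (x + e n * u))\<^sup>2 / (2 * (e n)\<^sup>2))))"
      by (rule lborel_integral_real_affine) (use e[of n] in auto)
    also have "\<dots> = (LINT u|lborel. \<bar>e n\<bar> *\<^sub>R (v (x + e n * u) *
        complex_of_real (sqrt (2 * pi) / e n * exp (- (x - (x + e n * u))\<^sup>2 / (2 * (e n)\<^sup>2)))))"
      by simp
    also have "\<dots> = (LINT u|lborel. complex_of_real (sqrt (2 * pi)) * (v (x + e n * u) * ?G u))"
      by (rule Bochner_Integration.integral_cong)
        (use e[of n] in \<open>auto simp: scaleR_conv_of_real power_mult_distrib field_simps\<close>)
    finally show ?thesis .
  qed
  \<comment> \<open>The bound \<open>B\<close> gives a Gaussian majorant, and continuity of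
    \<open>v\<close> at \<open>x\<close> gives the pointwise limit.\<close>
  have lim2: "(\<lambda>n. LINT u|lborel. complex_of_real (sqrt (2 * pi)) * (v (x + e n * u) * ?G u))
      \<longlonglongrightarrow> (LINT u|lborel. complex_of_real (sqrt (2 * pi)) * (v x * ?G u))"
  proof (rule integral_dominated_convergence[where w="\<lambda>u. sqrt (2 * pi) * (B * norm (?G u))"])
    show "AE u in lborel. (\<lambda>n. complex_of_real (sqrt (2 * pi)) * (v (x + e n * u) * ?G u))
        \<longlonglongrightarrow> complex_of_real (sqrt (2 * pi)) * (v x * ?G u)"
    proof (rule AE_I2)
      fix u :: real
      have "(\<lambda>n. x + e n * u) \<longlonglongrightarrow> x + 0 * u"
        by (intro tendsto_intros e0)
      then have "(\<lambda>n. v (x + e n * u)) \<longlonglongrightarrow> v x"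
        using cont by (intro isCont_tendsto_compose[of x v]) (auto simp: continuous_on_eq_continuous_at)
      then show "(\<lambda>n. complex_of_real (sqrt (2 * pi)) * (v (x + e n * u) * ?G u))
        \<longlonglongrightarrow> complex_of_real (sqrt (2 * pi)) * (v x * ?G u)"
        by (intro tendsto_intros)
    qed
    show "AE u in lborel. norm (complex_of_real (sqrt (2 * pi)) * (v (x + e n * u) * ?G u))
        \<le> sqrt (2 * pi) * (B * norm (?G u))" for n
      using bd by (auto simp: norm_mult mult_right_mono)
    show "integrable lborel (\<lambda>u. sqrt (2 * pi) * (B * norm (?G u)))"
      by (intro integrable_mult_right integrable_norm iG)
  qed auto
  have "(LINT u|lborel. complex_of_real (sqrt (2 * pi)) * (v x * ?G u)) = complex_of_real (2 * pi) * v x"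
    using IG by (simp flip: of_real_mult)
  moreover have "?I \<longlonglongrightarrow> (LINT u|lborel. complex_of_real (sqrt (2 * pi)) * (v x * ?G u))"
    using lim2 by (simp only: eq)
  ultimately show ?thesis
    using LIMSEQ_unique[OF lim1] by (simp only:)
qed

section \<open>Band-limited wave packets\<close>

definition cardinal_sine :: "real \<Rightarrow> real" where
  "cardinal_sine x = (if x = 0 then 1 else sin x / x)"

lemma continuous_on_cardinal_sine[continuous_intros]:
  "continuous_on S f \<Longrightarrow> continuous_on S (\<lambda>x. cardinal_sine (f x))"
  unfolding cardinal_sine_def by (rule continuous_on_sinc)

lemma measurable_cardinal_sine[measurable]: "cardinal_sine \<in> borel_measurable borel"
  by (intro borel_measurable_continuous_onI continuous_intros)

lemma abs_cardinal_sine_le: "\<bar>cardinal_sine x\<bar> \<le> 1"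
  using abs_sin_x_le_abs_x[of x] by (auto simp: cardinal_sine_def abs_divide divide_le_eq)

text \<open>Add the two bounds by 1 for the squares of \<open>cardinal_sine x\<close> and of
  \<open>x * cardinal_sine x\<close>, the latter being \<open>sin x\<close>.\<close>

lemma cardinal_sine_sq_le: "(cardinal_sine x)\<^sup>2 \<le> 2 / (1 + x\<^sup>2)"
proof -
  have "(cardinal_sine x)\<^sup>2 \<le> 1"
    using abs_cardinal_sine_le by (simp add: abs_square_le_1)
  moreover have "(x * cardinal_sine x)\<^sup>2 \<le> 1"
    using abs_sin_le_one[of x] by (auto simp: cardinal_sine_def abs_square_le_1)
  ultimately have "(cardinal_sine x)\<^sup>2 * (1 + x\<^sup>2) \<le> 2"
    by (simp add: algebra_simps power_mult_distrib)
  then show ?thesis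
    by (simp add: pos_le_divide_eq add_pos_nonneg)
qed

lemma cardinal_sine_pos: "\<bar>x\<bar> < pi \<Longrightarrow> 0 < cardinal_sine x"
proof -
  assume *: "\<bar>x\<bar> < pi"
  consider "x = 0" | "x > 0" | "x < 0" by linarith
  then show ?thesis
  proof cases
    case 3
    then have "sin (- x) > 0" using * by (intro sin_gt_zero) auto
    then show ?thesis using 3 by (simp add: cardinal_sine_def divide_neg_neg)
  qed (use * in \<open>auto simp: cardinal_sine_def sin_gt_zero\<close>)
qed

text \<open>Writes the cardinal sine as a mean of characters with frequencies in
  \<open>{-1..1}\<close>, so that multiplying by it averages a Fourier transform over
  shifts.\<close>

lemma cardinal_sine_eq_integral:
  "complex_of_real (cardinal_sine x)
    = (LINT u|lborel. complex_of_real (indicator {-1..1::real} u / 2) * cis (x * u))"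
proof (cases "x = 0")
  case True
  have "(LINT u|lborel. complex_of_real (indicator {-1..1::real} u / 2)) = complex_of_real (LINT u|lborel. indicator {-1..1::real} u / 2)"
    by (rule integral_complex_of_real)
  then show ?thesis using True by (simp add: cardinal_sine_def)
next
  case False
  let ?F = "\<lambda>u. cis (x * u) / (2 * \<i> * x)"
  have "(LINT u|lborel. indicator {-1..1} u *\<^sub>R (cis (x * u) / 2)) = ?F 1 - ?F (-1)"
  proof (rule integral_FTC_atLeastAtMost)
    show "(?F has_vector_derivative cis (x * u) / 2) (at u within {-1..1})" for u
      unfolding cis_conv_exp using False
      by (auto intro!: derivative_eq_intros has_vector_derivative_real_field simp: field_simps)
  qed (auto intro!: continuous_intros)
  also have "\<dots> = complex_of_real (cardinal_sine x)"
    using False by (simp add: cardinal_sine_def complex_eq_iff Re_divide Im_divide power2_eq_square)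
  finally show ?thesis by (simp add: scaleR_conv_of_real)
qed

text \<open>After Gaussian regularisation, each factor averages the transform over a window of
  half-width \<open>a\<close>, starting from the Gaussian itself.\<close>

lemma regularised_fourier_cardinal_sine_power_le:
  assumes e: "0 < e" and a: "0 \<le> a" and z: "real k * a \<le> \<bar>\<zeta>\<bar>"
  shows "norm (LINT y|lborel. complex_of_real (cardinal_sine (a * y) ^ k)
            * complex_of_real (exp (- (e * y)\<^sup>2 / 2)) * cis (- (\<zeta> * y)))
      \<le> sqrt (2 * pi) / e * exp (- (\<bar>\<zeta>\<bar> - real k * a)\<^sup>2 / (2 * e\<^sup>2))"
  using z
proof (induction k arbitrary: \<zeta>)
  case 0
  have "(LINT y|lborel. complex_of_real (exp (- (e * y)\<^sup>2 / 2)) * cis (y * (- \<zeta>)))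
      = complex_of_real (sqrt (2 * pi) / e * exp (- (- \<zeta>)\<^sup>2 / (2 * e\<^sup>2)))"
    by (rule integral_gaussian_cis(2)[OF e])
  then show ?case using e by (simp add: mult.commute norm_divide norm_mult)
next
  case (Suc k)
  let ?c = "\<lambda>u. complex_of_real (indicator {-1..1::real} u / 2)"
  let ?f = "\<lambda>y. complex_of_real (cardinal_sine (a * y) ^ k)
            * complex_of_real (exp (- (e * y)\<^sup>2 / 2)) * cis (- (\<zeta> * y))"
  let ?b = "sqrt (2 * pi) / e * exp (- (\<bar>\<zeta>\<bar> - real (Suc k) * a)\<^sup>2 / (2 * e\<^sup>2))"
  let ?A = "\<lambda>u. LINT y|lborel. ?f y * cis (a * y * u)"
  have f: "integrable lborel ?f"
  proof (rule Bochner_Integration.integrable_bound[OF integral_gaussian_cis(1)[OF e, of 0]])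
    show "AE x in lborel. norm (?f x) \<le> norm (complex_of_real (exp (- (e * x)\<^sup>2 / 2)) * cis (x * 0))"
      using abs_cardinal_sine_le by (auto simp: norm_mult norm_power power_abs intro!: power_le_one)
  qed measurable
  have ci: "integrable lborel (\<lambda>u::real. indicator {-1..1::real} u / 2 :: real)"
    by (auto intro!: integrable_real_indicator)
  then have c: "integrable lborel ?c"
    by (rule integrable_of_real)
  have "(LINT y|lborel. complex_of_real (cardinal_sine (a * y) ^ Suc k)
            * complex_of_real (exp (- (e * y)\<^sup>2 / 2)) * cis (- (\<zeta> * y)))
      = (LINT y|lborel. ?f y * (LINT u|lborel. ?c u * cis (a * y * u)))"
    unfolding cardinal_sine_eq_integral[symmetric]
    by (rule Bochner_Integration.integral_cong) (auto simp: mult_ac)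
  also have "\<dots> = (LINT u|lborel. ?c u * ?A u)"
    by (rule Fubini_bounded_kernel(2)[OF f c, where k="\<lambda>y u. cis (a * y * u)"])
      (auto intro!: continuous_intros)
  finally have eq: "(LINT y|lborel. complex_of_real (cardinal_sine (a * y) ^ Suc k)
            * complex_of_real (exp (- (e * y)\<^sup>2 / 2)) * cis (- (\<zeta> * y))) = (LINT u|lborel. ?c u * ?A u)" .
  have "norm (LINT u|lborel. ?c u * ?A u) \<le> (LINT u|lborel. indicator {-1..1::real} u / 2 * ?b)"
  proof (rule Bochner_Integration.integral_norm_bound_integral)
    show "integrable lborel (\<lambda>u. ?c u * (LINT y|lborel. ?f y * cis (a * y * u)))"
      by (rule Fubini_bounded_kernel(1)[OF c f, where k="\<lambda>u y. cis (a * y * u)"])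
        (auto intro!: continuous_intros)
    show "integrable lborel (\<lambda>u. indicator {-1..1::real} u / 2 * ?b)"
      using ci by (intro integrable_mult_left)
    fix u :: real
    show "norm (?c u * (LINT y|lborel. ?f y * cis (a * y * u))) \<le> indicator {-1..1} u / 2 * ?b"
    proof (cases "u \<in> {-1..1}")
      case True
      have "\<bar>a * u\<bar> \<le> a" using True a by (auto simp: abs_mult mult_left_le)
      \<comment> \<open>A shift of the frequency by at most \<open>a\<close> is paid for by the one
        factor that has been removed, so the distance to the shrunken band does not
        decrease.\<close>
      then have 1: "\<bar>\<zeta>\<bar> - real (Suc k) * a \<le> \<bar>\<zeta> - a * u\<bar> - real k * a"
        by (simp add: algebra_simps)
      have f_shift: "?f y * cis (a * y * u) = complex_of_real (cardinal_sine (a * y) ^ k)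
            * complex_of_real (exp (- (e * y)\<^sup>2 / 2)) * cis (- ((\<zeta> - a * u) * y))" for y
        by (simp add: mult.assoc cis_mult algebra_simps)
      have "real k * a \<le> \<bar>\<zeta> - a * u\<bar>"
        using 1 Suc.prems by linarith
      then have "norm (LINT y|lborel. ?f y * cis (a * y * u))
          \<le> sqrt (2 * pi) / e * exp (- (\<bar>\<zeta> - a * u\<bar> - real k * a)\<^sup>2 / (2 * e\<^sup>2))"
        unfolding f_shift by (rule Suc.IH)
      also have "\<dots> \<le> ?b"
      proof -
        have "(\<bar>\<zeta>\<bar> - real (Suc k) * a)\<^sup>2 \<le> (\<bar>\<zeta> - a * u\<bar> - real k * a)\<^sup>2"
          using 1 Suc.prems by (intro power_mono) auto
        then show ?thesis
          using e by (intro mult_left_mono) (auto simp: divide_right_mono)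
      qed
      finally show ?thesis using True by (simp add: norm_mult norm_divide)
    qed simp
  qed
  \<comment> \<open>The weight has total mass 1, so averaging preserves the bound.\<close>
  also have "(LINT u|lborel. indicator {-1..1::real} u / 2 * ?b) = ?b"
    unfolding integral_mult_left_zero by simp
  finally show ?case
    unfolding eq .
qed

text \<open>Integrability on the positive half-line is reflected to the negative one and the two are
  added.\<close>

lemma integrable_inverse_square: "integrable lborel (\<lambda>x::real. 1 / (1 + x\<^sup>2))"
proof -
  have i: "integrable lborel (\<lambda>x::real. indicator {0<..} x *\<^sub>R (1 / (1 + x\<^sup>2)))"
    using integrable_I0i_1_div_plus_square
    unfolding interval_lebesgue_integrable_def set_integrable_def zero_ereal_def by simp
  have j: "integrable lborel (\<lambda>x::real. indicator {0<..} (0 + - 1 * x) *\<^sub>R (1 / (1 + (0 + - 1 * x)\<^sup>2)))"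
    by (rule lborel_integrable_real_affine[OF i]) simp
  have "integrable lborel (\<lambda>x::real. indicator {0<..} x *\<^sub>R (1 / (1 + x\<^sup>2)) +
      indicator {0<..} (0 + - 1 * x) *\<^sub>R (1 / (1 + (0 + - 1 * x)\<^sup>2)))"
    by (rule Bochner_Integration.integrable_add[OF i j])
  then show ?thesis
    \<comment> \<open>Both indicators vanish at 0, so the comparison holds only almost
      everywhere.\<close>
    by (rule Bochner_Integration.integrable_bound) (use AE_lborel_singleton[of "0::real"] in \<open>auto simp: indicator_def elim!: eventually_mono\<close>)
qed

text \<open>Each factor has bandwidth \<open>1 / K\<close>, so the \<open>K\<close> factors together
  have band \<open>{-1..1}\<close> for every positive \<open>K\<close>, while the decay improves
  with \<open>K\<close>. A large \<open>K\<close> keeps \<open>\<bar>wave K t\<bar> powr p\<close>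
  integrable for small \<open>p\<close>.\<close>

definition wave :: "nat \<Rightarrow> real \<Rightarrow> real" where
  "wave K t = cardinal_sine (t / real K) ^ K"

lemma continuous_on_wave[continuous_intros]:
  "continuous_on S f \<Longrightarrow> continuous_on S (\<lambda>x. wave K (f x))"
  unfolding wave_def divide_inverse by (intro continuous_intros)

lemma measurable_wave[measurable]: "wave K \<in> borel_measurable borel"
  by (intro borel_measurable_continuous_onI continuous_intros)

lemma abs_wave_le: "\<bar>wave K t\<bar> \<le> 1"
  using abs_cardinal_sine_le by (auto simp: wave_def power_abs intro!: power_le_one)

lemma wave_0[simp]: "wave K 0 = 1"
  by (simp add: wave_def cardinal_sine_def)

text \<open>As the cardinal sine is bounded by 1 in modulus, the exponent \<open>real K * p\<close>
  may be lowered to 2.\<close>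

lemma wave_powr_le:
  assumes "2 \<le> real K * p" "K \<ge> 1"
  shows "\<bar>wave K t\<bar> powr p \<le> 2 * (real K)\<^sup>2 * (1 / (1 + t\<^sup>2))"
proof (cases "cardinal_sine (t / real K) = 0")
  case False
  let ?c = "\<bar>cardinal_sine (t / real K)\<bar>"
  have c: "0 < ?c" "?c \<le> 1" using False abs_cardinal_sine_le by auto
  have "\<bar>wave K t\<bar> powr p = ?c powr (real K * p)"
    using c by (simp add: wave_def power_abs powr_powr flip: powr_realpow)
  also have "\<dots> \<le> ?c powr 2"
    using c(2) assms by (intro powr_mono') auto
  also have "\<dots> = (cardinal_sine (t / real K))\<^sup>2"
    using c by (simp add: powr_numeral)
  also have "\<dots> \<le> 2 / (1 + (t / real K)\<^sup>2)"
    by (rule cardinal_sine_sq_le)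
  also have "\<dots> \<le> 2 * (real K)\<^sup>2 * (1 / (1 + t\<^sup>2))"
  proof -
    have K: "1 \<le> (real K)\<^sup>2" using assms by simp
    have "2 / (1 + (t / real K)\<^sup>2) = 2 * (real K)\<^sup>2 / ((real K)\<^sup>2 + t\<^sup>2)"
      using assms by (simp add: field_simps power_divide)
    also have "\<dots> \<le> 2 * (real K)\<^sup>2 / (1 + t\<^sup>2)"
      using K assms by (intro divide_left_mono) (auto intro!: mult_pos_pos add_pos_nonneg)
    finally show ?thesis by simp
  qed
  finally show ?thesis .
qed (use assms in \<open>simp add: wave_def power_0_left\<close>)

lemma abs_wave_bound:
  assumes "2 \<le> K"
  shows "\<bar>wave K t\<bar> \<le> 2 * (real K)\<^sup>2 * (1 / (1 + t\<^sup>2))"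
  using wave_powr_le[of K 1 t] assms by simp

lemma integrable_wave_powr:
  assumes "2 \<le> real K * p" "K \<ge> 1"
  shows "integrable lborel (\<lambda>t. \<bar>wave K t\<bar> powr p)"
  by (rule Bochner_Integration.integrable_bound
      [OF integrable_mult_right[of "2 * (real K)\<^sup>2", OF integrable_inverse_square]])
    (use wave_powr_le[OF assms] in auto)

lemma integrable_wave:
  assumes "2 \<le> K"
  shows "integrable lborel (\<lambda>t. wave K t)"
proof -
  have "integrable lborel (\<lambda>t. \<bar>wave K t\<bar> powr 1)"
    by (rule integrable_wave_powr) (use assms in auto)
  then show ?thesis by (subst integrable_norm_iff[symmetric]) auto
qed

text \<open>For \<open>t\<close> in a full period, \<open>K \<ge> 2\<close> keeps
  \<open>t / K\<close> within \<open>pi / 2\<close> of 0, where the cardinal sine is positive;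
  compactness makes the bound uniform.\<close>

lemma wave_lower_bound:
  assumes "2 \<le> K"
  obtains c where "0 < c" "\<And>t. t \<in> {-pi..pi} \<Longrightarrow> c \<le> wave K t"
proof -
  obtain s where s: "s \<in> {-pi..pi}" "\<And>t. t \<in> {-pi..pi} \<Longrightarrow> wave K s \<le> wave K t"
    using continuous_attains_inf[of "{-pi..pi}" "wave K"] continuous_on_wave[OF continuous_on_id]
    by auto
  have "\<bar>s / real K\<bar> \<le> pi / 2"
    unfolding abs_divide using s(1) assms by (intro frac_le) auto
  then have "0 < cardinal_sine (s / real K)"
    using pi_gt_zero by (intro cardinal_sine_pos) linarith
  then have "0 < wave K s"
    by (simp add: wave_def)
  with s(2) that show thesis by blast
qed

text \<open>Apply the regularised estimate with \<open>a = 1 / K\<close> and \<open>k = K\<close>,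
  so that the windows add up to half-width 1. Outside the band the Gaussian exponential beats the
  prefactor \<open>1 / e n\<close>, and the regularised integrals tend both to 0 and to the
  transform.\<close>

lemma fourier_wave_eq_0:
  assumes K: "2 \<le> K" and z: "1 < \<bar>\<zeta>\<bar>"
  shows "fourier (\<lambda>t. complex_of_real (wave K t)) \<zeta> = 0"
proof -
  define e where "e n = 1 / real (Suc n)" for n
  have e: "0 < e n" for n by (simp add: e_def)
  have e0: "e \<longlonglongrightarrow> 0"
    unfolding e_def by (rule LIMSEQ_inverse_real_of_nat[unfolded inverse_eq_divide])
  let ?I = "\<lambda>n. LINT y|lborel. complex_of_real (wave K y)
            * complex_of_real (exp (- (e n * y)\<^sup>2 / 2)) * cis (- (\<zeta> * y))"
  have "?I \<longlonglongrightarrow> fourier (\<lambda>t. complex_of_real (wave K t)) \<zeta>"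
    unfolding fourier_def
  proof (rule integral_dominated_convergence[where w="\<lambda>t. \<bar>wave K t\<bar>"])
    show "AE y in lborel. (\<lambda>n. complex_of_real (wave K y) * complex_of_real (exp (- (e n * y)\<^sup>2 / 2)) * cis (- (\<zeta> * y)))
        \<longlonglongrightarrow> complex_of_real (wave K y) * cis (- (\<zeta> * y))"
    proof (rule AE_I2)
      fix y :: real
      have "(\<lambda>n. complex_of_real (wave K y) * complex_of_real (exp (- (e n * y)\<^sup>2 / 2)) * cis (- (\<zeta> * y)))
        \<longlonglongrightarrow> complex_of_real (wave K y) * complex_of_real (exp (- (0 * y)\<^sup>2 / 2)) * cis (- (\<zeta> * y))"
        by (intro tendsto_intros e0) auto
      then show "(\<lambda>n. complex_of_real (wave K y) * complex_of_real (exp (- (e n * y)\<^sup>2 / 2)) * cis (- (\<zeta> * y)))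
        \<longlonglongrightarrow> complex_of_real (wave K y) * cis (- (\<zeta> * y))" by simp
    qed
  qed (use integrable_wave[OF K] in \<open>auto simp: norm_mult mult_left_le\<close>)
  moreover have "?I \<longlonglongrightarrow> 0"
  proof (rule Lim_null_comparison)
    define d where "d = \<bar>\<zeta>\<bar> - 1"
    have d: "0 < d" using z by (simp add: d_def)
    show "\<forall>\<^sub>F n in sequentially. norm (?I n)
        \<le> sqrt (2 * pi) * real (Suc n) * exp (- (d\<^sup>2 * (real (Suc n))\<^sup>2 / 2))"
    proof (rule always_eventually, rule allI)
      fix n
      have "norm (?I n) \<le> sqrt (2 * pi) / e n * exp (- (\<bar>\<zeta>\<bar> - real K * (1 / real K))\<^sup>2 / (2 * (e n)\<^sup>2))"
        using regularised_fourier_cardinal_sine_power_le[OF e, of "1 / real K" K \<zeta> n] K z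
        by (simp add: wave_def)
      also have "\<dots> = sqrt (2 * pi) * real (Suc n) * exp (- (d\<^sup>2 * (real (Suc n))\<^sup>2 / 2))"
        using K by (simp add: d_def e_def power_divide)
      finally show "norm (?I n) \<le> sqrt (2 * pi) * real (Suc n) * exp (- (d\<^sup>2 * (real (Suc n))\<^sup>2 / 2))" .
    qed
    show "(\<lambda>n. sqrt (2 * pi) * real (Suc n) * exp (- (d\<^sup>2 * (real (Suc n))\<^sup>2 / 2))) \<longlonglongrightarrow> 0"
      using d by real_asymp
  qed
  ultimately show ?thesis by (rule LIMSEQ_unique)
qed

definition wave_packet :: "nat \<Rightarrow> real \<Rightarrow> real \<Rightarrow> real \<Rightarrow> complex" where
  "wave_packet K s \<xi> t = complex_of_real (wave K (t - s)) * cis (\<xi> * t)"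

lemma continuous_on_wave_packet[continuous_intros]:
  "continuous_on S f \<Longrightarrow> continuous_on S (\<lambda>x. wave_packet K s \<xi> (f x))"
  unfolding wave_packet_def by (intro continuous_intros)

lemma measurable_wave_packet[measurable]: "wave_packet K s \<xi> \<in> borel_measurable borel"
  by (intro borel_measurable_continuous_onI continuous_intros)

lemma norm_wave_packet: "norm (wave_packet K s \<xi> t) = \<bar>wave K (t - s)\<bar>"
  by (simp add: wave_packet_def norm_mult)

lemma integrable_wave_packet:
  assumes "2 \<le> K"
  shows "integrable lborel (wave_packet K s \<xi>)"
proof -
  have "integrable lborel (\<lambda>t. wave K (- s + 1 * t))"
    by (rule lborel_integrable_real_affine[OF integrable_wave[OF assms]]) simp
  then have "integrable lborel (\<lambda>t. complex_of_real (wave K (t - s)))"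
    by (simp add: integrable_of_real)
  then show ?thesis
    unfolding wave_packet_def[abs_def] by (rule integrable_mult_cis) simp
qed

text \<open>Modulation translates the transform by \<open>\<xi>\<close>, and the shift
  \<open>s\<close> only contributes a factor of modulus 1.\<close>

lemma fourier_wave_packet_eq_0:
  assumes K: "2 \<le> K" and z: "1 < \<bar>\<zeta> - \<xi>\<bar>"
  shows "fourier (wave_packet K s \<xi>) \<zeta> = 0"
proof -
  have "fourier (wave_packet K s \<xi>) \<zeta>
      = \<bar>1\<bar> *\<^sub>R (LINT t|lborel. wave_packet K s \<xi> (s + 1 * t) * cis (- (\<zeta> * (s + 1 * t))))"
    unfolding fourier_def by (rule lborel_integral_real_affine) simp
  also have "\<dots> = (LINT t|lborel. cis ((\<xi> - \<zeta>) * s) * (complex_of_real (wave K t) * cis (- ((\<zeta> - \<xi>) * t))))"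
    by (auto simp: wave_packet_def mult_ac cis_mult intro!: Bochner_Integration.integral_cong)
      (auto simp: algebra_simps)
  also have "\<dots> = cis ((\<xi> - \<zeta>) * s) * fourier (\<lambda>t. complex_of_real (wave K t)) (\<zeta> - \<xi>)"
    by (simp add: fourier_def)
  finally show ?thesis using fourier_wave_eq_0[OF K z] by simp
qed

lemma integrable_fourier_wave_packet:
  assumes "2 \<le> K"
  shows "integrable lborel (fourier (wave_packet K s \<xi>))"
  by (rule integrable_fourier_band_limited[OF integrable_wave_packet[OF assms], where a="\<xi> - 1" and b="\<xi> + 1"])
    (auto intro!: fourier_wave_packet_eq_0[OF assms])

lemma fourier_inversion_wave_packet:
  assumes "2 \<le> K"
  shows "(LINT \<zeta>|lborel. fourier (wave_packet K s \<xi>) \<zeta> * cis (x * \<zeta>))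
    = complex_of_real (2 * pi) * wave_packet K s \<xi> x"
  by (rule fourier_inversion[OF integrable_wave_packet[OF assms] _ _ integrable_fourier_wave_packet[OF assms], where B=1])
    (auto intro!: continuous_intros simp: norm_wave_packet abs_wave_le)

section \<open>Fourier multipliers on tensor products\<close>

text \<open>Lebesgue measure on \<open>real^'n\<close> is a product indexed by \<open>Basis\<close>;
  this converts such products into products over coordinates, with \<open>THE\<close> inverting the
  injective map \<open>axis\<close>.\<close>

lemma prod_Basis_vec:
  fixes F :: "'n::finite \<Rightarrow> real \<Rightarrow> 'a::comm_monoid_mult"
  shows "(\<Prod>b\<in>Basis. F (THE i. b = axis i 1) (h (b::real^'n))) = (\<Prod>i\<in>UNIV. F i (h (axis i 1)))"
proof -
  have B: "(Basis :: (real^'n) set) = range (\<lambda>i. axis i 1)"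
    by (auto simp: Basis_vec_def)
  have inj: "inj (\<lambda>i::'n. axis i (1::real))"
    by (auto simp: inj_def axis_eq_axis)
  have "(THE j. axis i (1::real) = axis j 1) = i" for i :: 'n
    by (rule the_equality) (auto simp: axis_eq_axis)
  then show ?thesis
    unfolding B by (simp add: prod.reindex[OF inj])
qed

lemma
  fixes v :: "'n::finite \<Rightarrow> real \<Rightarrow> complex"
  assumes v: "\<And>i. integrable lborel (v i)"
  shows integrable_prod_vec: "integrable lborel (\<lambda>y::real^'n. \<Prod>i\<in>UNIV. v i (y $ i))"
    and integral_prod_vec: "(LINT y|lborel. (\<Prod>i\<in>UNIV. v i ((y::real^'n) $ i))) = (\<Prod>i\<in>UNIV. LINT t|lborel. v i t)"
proof -
  interpret product_sigma_finite "\<lambda>_::real^'n. lborel :: real measure"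
    by standard
  define ix where "ix b = (THE i::'n. b = axis i (1::real))" for b
  \<comment> \<open>By \<open>lborel_eq\<close>, \<open>lborel\<close> is the image of the product
    measure under this map.\<close>
  let ?e = "\<lambda>f. \<Sum>b\<in>Basis. f b *\<^sub>R (b::real^'n)"
  let ?V = "\<lambda>y::real^'n. \<Prod>i\<in>UNIV. v i (y $ i)"
  have [measurable]: "v i \<in> borel_measurable borel" for i using v[of i] by auto
  have e[measurable]: "?e \<in> measurable (\<Pi>\<^sub>M b\<in>Basis. lborel) borel"
    by measurable
  have V[measurable]: "?V \<in> borel_measurable borel"
    by measurable
  have Ve: "?V (?e f) = (\<Prod>b\<in>Basis. v (ix b) (f b))" for f
  proof -
    have "?e f $ i = f (axis i 1)" for i
    proof -
      have "?e f $ i = ?e f \<bullet> axis i 1" by (simp add: inner_axis)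
      also have "\<dots> = f (axis i 1)"
        by (rule inner_sum_left_Basis) auto
      finally show ?thesis .
    qed
    then show ?thesis
      unfolding ix_def using prod_Basis_vec[of v f] by simp
  qed
  have "integrable (\<Pi>\<^sub>M b\<in>Basis. lborel) (\<lambda>f. ?V (?e f))"
    unfolding Ve by (rule product_integrable_prod) (auto simp: v)
  then show "integrable lborel ?V"
    by (subst lborel_eq) (simp add: integrable_distr_eq)
  have "(LINT y|lborel. ?V y) = (LINT f|(\<Pi>\<^sub>M b\<in>Basis. lborel). ?V (?e f))"
    by (subst lborel_eq) (simp add: integral_distr)
  also have "\<dots> = (\<Prod>b\<in>Basis. LINT t|lborel. v (ix b) t)"
    unfolding Ve by (rule product_integral_prod) (auto simp: v)
  also have "\<dots> = (\<Prod>i\<in>UNIV. LINT t|lborel. v i t)"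
    unfolding ix_def using prod_Basis_vec[of "\<lambda>i _. LINT t|lborel. v i t" "\<lambda>_. 0"] by simp
  finally show "(LINT y|lborel. ?V y) = (\<Prod>i\<in>UNIV. LINT t|lborel. v i t)" .
qed

lemma nn_integral_prod_vec:
  fixes f :: "'n::finite \<Rightarrow> real \<Rightarrow> ennreal"
  assumes [measurable]: "\<And>i. f i \<in> borel_measurable borel"
  shows "(\<integral>\<^sup>+y. (\<Prod>i\<in>UNIV. f i ((y::real^'n) $ i)) \<partial>lborel) = (\<Prod>i\<in>UNIV. \<integral>\<^sup>+t. f i t \<partial>lborel)"
proof -
  define ix where "ix b = (THE i::'n. b = axis i (1::real))" for b
  have "(\<Prod>i\<in>UNIV. f i (y $ i)) = (\<Prod>b\<in>Basis. f (ix b) (y \<bullet> b))" for y :: "real^'n"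
    unfolding ix_def using prod_Basis_vec[of f "\<lambda>b. y \<bullet> b"] by (simp add: inner_axis)
  then have "(\<integral>\<^sup>+y. (\<Prod>i\<in>UNIV. f i ((y::real^'n) $ i)) \<partial>lborel)
      = (\<integral>\<^sup>+y. (\<Prod>b\<in>Basis. f (ix b) ((y::real^'n) \<bullet> b)) \<partial>lborel)"
    by simp
  also have "\<dots> = (\<Prod>b\<in>Basis. \<integral>\<^sup>+t. f (ix b) t \<partial>lborel)"
    by (rule nn_integral_lborel_prod) auto
  also have "\<dots> = (\<Prod>i\<in>UNIV. \<integral>\<^sup>+t. f i t \<partial>lborel)"
    unfolding ix_def using prod_Basis_vec[of "\<lambda>i _. \<integral>\<^sup>+t. f i t \<partial>lborel" "\<lambda>_. 0"] by simp
  finally show ?thesis .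
qed

lemma cis_sum: "cis (\<Sum>i\<in>A. f i) = (\<Prod>i\<in>A. cis (f i))"
  by (induction A rule: infinite_finite_induct) (simp_all flip: cis_mult)

text \<open>The tensor product is an eigenfunction of any multiplier that is constant on its
  spectrum. Fubini lets \<open>c\<close> act on the product of the transforms, where it may be
  replaced by the constant \<kappa>, and inversion in each coordinate restores the function.\<close>

lemma
  fixes c :: "real^'n::finite \<Rightarrow> real" and v :: "'n \<Rightarrow> real \<Rightarrow> complex"
  assumes c: "integrable lborel c"
    and v: "\<And>i. integrable lborel (v i)"
    and Fv: "\<And>i. integrable lborel (fourier (v i))"
    and inv: "\<And>i x. (LINT \<zeta>|lborel. fourier (v i) \<zeta> * cis (x * \<zeta>)) = complex_of_real (2 * pi) * v i x"
    and supp: "\<And>\<zeta>. (\<And>i. fourier (v i) (\<zeta> $ i) \<noteq> 0) \<Longrightarrow> c \<zeta> = \<kappa>"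
  shows integrable_mult_mkernel:
      "integrable lborel (\<lambda>y. (\<Prod>i\<in>UNIV. v i (y $ i)) * mkernel c (x - y))"
    and integral_mult_mkernel:
      "(LINT y|lborel. (\<Prod>i\<in>UNIV. v i (y $ i)) * mkernel c (x - y))
        = complex_of_real \<kappa> * (\<Prod>i\<in>UNIV. v i (x $ i))"
proof -
  let ?V = "\<lambda>y::real^'n. \<Prod>i\<in>UNIV. v i (y $ i)"
  let ?C = "complex_of_real (1 / (2 * pi) ^ CARD('n))"
  have V: "integrable lborel ?V" by (rule integrable_prod_vec[OF v])
  have c': "integrable lborel (\<lambda>\<zeta>. complex_of_real (c \<zeta>))"
    using c by (rule integrable_of_real)
  note Fub = Fubini_bounded_kernel[OF V c', where k="\<lambda>y \<zeta>. cis ((x - y) \<bullet> \<zeta>)"]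
  have k1: "continuous_on UNIV (\<lambda>z::(real^'n) \<times> (real^'n). cis ((x - fst z) \<bullet> snd z))"
    by (intro continuous_intros)
  have k2: "norm (cis ((x - y) \<bullet> \<zeta>)) \<le> 1" for y \<zeta> :: "real^'n" by simp
  have eq: "?V y * mkernel c (x - y) = ?C * (?V y * (LINT \<zeta>|lborel. complex_of_real (c \<zeta>) * cis ((x - y) \<bullet> \<zeta>)))" for y
    by (simp add: mkernel_def)
  show "integrable lborel (\<lambda>y. ?V y * mkernel c (x - y))"
    unfolding eq by (intro integrable_mult_right Fub k1 k2)
  have inner: "(LINT y|lborel. ?V y * cis ((x - y) \<bullet> \<zeta>)) = cis (x \<bullet> \<zeta>) * (\<Prod>i\<in>UNIV. fourier (v i) (\<zeta> $ i))" for \<zeta>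
  proof -
    have "?V y * cis ((x - y) \<bullet> \<zeta>) = cis (x \<bullet> \<zeta>) * (\<Prod>i\<in>UNIV. v i (y $ i) * cis (- (\<zeta> $ i * y $ i)))" for y
    proof -
      have "cis ((x - y) \<bullet> \<zeta>) = cis (x \<bullet> \<zeta>) * cis (- (y \<bullet> \<zeta>))"
        by (simp add: cis_mult inner_diff_left)
      also have "cis (- (y \<bullet> \<zeta>)) = (\<Prod>i\<in>UNIV. cis (- (\<zeta> $ i * y $ i)))"
        by (simp add: inner_vec_def mult.commute flip: cis_sum sum_negf)
      finally show ?thesis by (simp add: prod.distrib)
    qed
    then have "(LINT y|lborel. ?V y * cis ((x - y) \<bullet> \<zeta>))
        = cis (x \<bullet> \<zeta>) * (LINT y|lborel. (\<Prod>i\<in>UNIV. v i ((y::real^'n) $ i) * cis (- (\<zeta> $ i * y $ i))))"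
      by simp
    also have "(LINT y|lborel. (\<Prod>i\<in>UNIV. v i ((y::real^'n) $ i) * cis (- (\<zeta> $ i * y $ i))))
        = (\<Prod>i\<in>UNIV. fourier (v i) (\<zeta> $ i))"
      unfolding fourier_def
      by (rule integral_prod_vec[where v="\<lambda>i t. v i t * cis (- (\<zeta> $ i * t))"])
        (intro integrable_mult_cis v, simp)
    finally show ?thesis .
  qed
  have "(LINT y|lborel. ?V y * mkernel c (x - y))
      = ?C * (LINT \<zeta>|lborel. complex_of_real (c \<zeta>) * (LINT y|lborel. ?V y * cis ((x - y) \<bullet> \<zeta>)))"
    unfolding eq integral_mult_right_zero Fub(2)[OF k1 k2] ..
  also have "(LINT \<zeta>|lborel. complex_of_real (c \<zeta>) * (LINT y|lborel. ?V y * cis ((x - y) \<bullet> \<zeta>)))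
      = (LINT \<zeta>|lborel. complex_of_real \<kappa> * (\<Prod>i\<in>UNIV. fourier (v i) (\<zeta> $ i) * cis (x $ i * \<zeta> $ i)))"
  proof (rule Bochner_Integration.integral_cong[OF refl])
    fix \<zeta> :: "real^'n"
    \<comment> \<open>Either some factor vanishes, and both sides are 0, or \<open>supp\<close>
      gives the value of \<open>c\<close>.\<close>
    have "complex_of_real (c \<zeta>) * (\<Prod>i\<in>UNIV. fourier (v i) (\<zeta> $ i))
        = complex_of_real \<kappa> * (\<Prod>i\<in>UNIV. fourier (v i) (\<zeta> $ i))"
      using supp[of \<zeta>] by auto
    moreover have "cis (x \<bullet> \<zeta>) = (\<Prod>i\<in>UNIV. cis (x $ i * \<zeta> $ i))"
      by (simp add: inner_vec_def flip: cis_sum)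
    ultimately show "complex_of_real (c \<zeta>) * (LINT y|lborel. ?V y * cis ((x - y) \<bullet> \<zeta>))
        = complex_of_real \<kappa> * (\<Prod>i\<in>UNIV. fourier (v i) (\<zeta> $ i) * cis (x $ i * \<zeta> $ i))"
      unfolding inner by (simp add: prod.distrib)
  qed
  also have "\<dots> = complex_of_real \<kappa> * (\<Prod>i\<in>UNIV. complex_of_real (2 * pi) * v i (x $ i))"
  proof -
    have "(LINT \<zeta>|lborel. (\<Prod>i\<in>UNIV. fourier (v i) ((\<zeta>::real^'n) $ i) * cis (x $ i * \<zeta> $ i)))
        = (\<Prod>i\<in>UNIV. LINT \<zeta>|lborel. fourier (v i) \<zeta> * cis (x $ i * \<zeta>))"
      by (rule integral_prod_vec[where v="\<lambda>i t. fourier (v i) t * cis (x $ i * t)"])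
        (intro integrable_mult_cis Fv, simp)
    then show ?thesis by (simp add: inv)
  qed
  finally show "(LINT y|lborel. ?V y * mkernel c (x - y)) = complex_of_real \<kappa> * ?V x"
    by (simp add: prod.distrib prod_constant power_mult_distrib)
qed

section \<open>Integrable functions as tempered distributions\<close>

definition regular_distribution :: "(real^'n::finite \<Rightarrow> complex) \<Rightarrow> (real^'n \<Rightarrow> complex) \<Rightarrow> complex" where
  "regular_distribution F g = (LINT y|lborel. F y * g y)"

lemma schwartz_bounded_measurable:
  fixes g :: "real^'n::finite \<Rightarrow> complex"
  assumes "schwartz g"
  shows "norm (g x) \<le> sch_seminorm 0 [] g" and "g \<in> borel_measurable borel"
proof -
  have d: "dpart is g differentiable (at x)" for "is" x
    using assms by (auto simp: schwartz_def smooth_fun_def)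
  from d[of "[]"] have "continuous_on UNIV g"
    by (auto intro!: continuous_at_imp_continuous_on differentiable_imp_continuous_within)
  then show "g \<in> borel_measurable borel"
    by (rule borel_measurable_continuous_onI)
  from assms obtain C where "\<forall>x. (1 + norm x) ^ 0 * norm (dpart [] g x) \<le> C"
    unfolding schwartz_def by blast
  then have "bdd_above (range (\<lambda>x. norm (g x)))"
    by (auto intro!: bdd_aboveI)
  then show "norm (g x) \<le> sch_seminorm 0 [] g"
    unfolding sch_seminorm_def by (auto intro: cSUP_upper)
qed

lemma tempered_regular_distribution:
  fixes F :: "real^'n::finite \<Rightarrow> complex"
  assumes F: "integrable lborel F"
  shows "tempered (regular_distribution F)"
proof -
  have int: "integrable lborel (\<lambda>y. F y * g y)" if "schwartz g" for g
  proof (rule Bochner_Integration.integrable_bound)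
    show "integrable lborel (\<lambda>y. sch_seminorm 0 [] g * norm (F y))"
      using F by auto
    show "(\<lambda>y. F y * g y) \<in> borel_measurable lborel"
      using F schwartz_bounded_measurable(2)[OF that] by auto
    show "AE y in lborel. norm (F y * g y) \<le> norm (sch_seminorm 0 [] g * norm (F y))"
    proof (rule AE_I2)
      fix y
      have "norm (g y) \<le> \<bar>sch_seminorm 0 [] g\<bar>"
        using schwartz_bounded_measurable(1)[OF that, of y] by linarith
      then show "norm (F y * g y) \<le> norm (sch_seminorm 0 [] g * norm (F y))"
        by (simp add: norm_mult abs_mult mult.commute mult_left_mono)
    qed
  qed
  have lin: "regular_distribution F (\<lambda>x. a * f x + b * g x)
      = a * regular_distribution F f + b * regular_distribution F g"
    if "schwartz f" "schwartz g" for f g a b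
  proof -
    have "regular_distribution F (\<lambda>x. a * f x + b * g x) = (LINT y|lborel. a * (F y * f y) + b * (F y * g y))"
      unfolding regular_distribution_def
      by (rule Bochner_Integration.integral_cong) (auto simp: algebra_simps)
    then show ?thesis
      using int[OF that(1)] int[OF that(2)] by (simp add: regular_distribution_def)
  qed
  \<comment> \<open>Order 0 suffices: the only list of length at most 0 is \<open>[]\<close>, and
    its unweighted seminorm is the supremum of \<open>norm (g x)\<close>.\<close>
  have "norm (regular_distribution F g) \<le> (LINT y|lborel. norm (F y)) *
      (\<Sum>is\<in>{is::'n list. length is \<le> 0}. sch_seminorm 0 is g)" if g: "schwartz g" for g
  proof -
    have "norm (regular_distribution F g) \<le> (LINT y|lborel. norm (F y) * sch_seminorm 0 [] g)"
      unfolding regular_distribution_def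
    proof (rule Bochner_Integration.integral_norm_bound_integral[OF int[OF g]])
      show "integrable lborel (\<lambda>y. norm (F y) * sch_seminorm 0 [] g)"
        using F by auto
    qed (auto simp: norm_mult intro!: mult_left_mono schwartz_bounded_measurable(1)[OF g])
    then show ?thesis by simp
  qed
  with lin show ?thesis
    unfolding tempered_def by blast
qed

lemma integrable_continuous_compact_support:
  fixes c :: "'a::euclidean_space \<Rightarrow> real"
  assumes "continuous_on UNIV c" "compact S" "\<And>x. x \<notin> S \<Longrightarrow> c x = 0"
  shows "integrable lborel c"
proof -
  have "integrable lborel (\<lambda>x. indicator S x *\<^sub>R c x)"
    using assms continuous_on_subset[OF assms(1)] by (intro borel_integrable_compact) auto
  also have "(\<lambda>x. indicator S x *\<^sub>R c x) = c"
    using assms(3) by (auto simp: indicator_def fun_eq_iff)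
  finally show ?thesis .
qed

section \<open>Sequence norms and dyadic blocks\<close>

lemma epow_mono: "x \<le> y \<Longrightarrow> 0 \<le> r \<Longrightarrow> epow x r \<le> epow y r"
  by (auto simp: epow_def top_unique less_top[symmetric] intro!: ennreal_leI powr_mono2 enn2real_mono)

lemma epow_ennreal: "0 \<le> x \<Longrightarrow> epow (ennreal x) r = ennreal (x powr r)"
  by (simp add: epow_def)

lemma epow_epow_inverse: "0 < r \<Longrightarrow> epow (epow x r) (1 / r) = x"
  by (cases x) (auto simp: epow_ennreal powr_powr epow_def)

text \<open>Serves to discard all blocks of the Besov norm except one.\<close>

lemma lq_norm_ge:
  assumes "0 < q"
  shows "a j \<le> lq_norm q a"
proof (cases "q = top")
  case True
  then show ?thesis by (auto simp: lq_norm_def intro: SUP_upper)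
next
  case False
  then have r: "0 < enn2real q"
    using assms by (simp add: enn2real_positive_iff less_top)
  have "a j = epow (epow (a j) (enn2real q)) (1 / enn2real q)"
    using epow_epow_inverse[OF r] by simp
  also have "\<dots> \<le> epow (\<integral>\<^sup>+ i. epow (a i) (enn2real q) \<partial>count_space UNIV) (1 / enn2real q)"
    using r by (intro epow_mono nn_integral_ge_point) auto
  finally show ?thesis using False by (simp add: lq_norm_def)
qed

text \<open>One formula covers every \<open>q\<close>: for \<open>q = top\<close> the value
  \<open>enn2real q\<close> is 0, hence \<open>1 / enn2real q = 0\<close> and the power of the
  cardinality is 1.\<close>

lemma lq_norm_finite_support_le:
  assumes q: "0 < q" and S: "finite S" "S \<noteq> {}" "\<And>k. k \<notin> S \<Longrightarrow> a k = 0"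
    and le: "\<And>k. a k \<le> ennreal A" and A: "0 \<le> A"
  shows "lq_norm q a \<le> ennreal (real (card S) powr (1 / enn2real q) * A)"
proof (cases "q = top")
  case True
  have "card S > 0" using S by (simp add: card_gt_0_iff)
  then show ?thesis using True le by (auto simp: lq_norm_def intro: SUP_least)
next
  case False
  define r where "r = enn2real q"
  have r: "0 < r"
    using assms False by (simp add: r_def enn2real_positive_iff less_top)
  have "(\<integral>\<^sup>+ i. epow (a i) r \<partial>count_space UNIV) = (\<Sum>i\<in>S. epow (a i) r)"
    using S r by (intro nn_integral_count_space') (auto simp: epow_def)
  also have "\<dots> \<le> (\<Sum>i\<in>S. ennreal (A powr r))"
    using epow_mono[OF le, of r] r A by (intro sum_mono) (simp add: epow_ennreal)
  also have "\<dots> = ennreal (real (card S) * A powr r)"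
    by (simp add: ennreal_mult ennreal_of_nat_eq_real_of_nat)
  finally have "epow (\<integral>\<^sup>+ i. epow (a i) r \<partial>count_space UNIV) (1 / r) \<le> epow (ennreal (real (card S) * A powr r)) (1 / r)"
    using r by (intro epow_mono) auto
  also have "\<dots> = ennreal (real (card S) powr (1 / r) * A)"
    using r A by (simp add: epow_ennreal powr_mult powr_powr)
  finally show ?thesis using False by (simp add: lq_norm_def r_def)
qed

section \<open>Integrability of the dyadic multipliers\<close>

lemma abs_le_maxnorm: "\<bar>x $ i\<bar> \<le> maxnorm x"
  unfolding maxnorm_def by (rule Max_ge) auto

lemma maxnorm_le: "(\<And>i. \<bar>x $ i\<bar> \<le> R) \<Longrightarrow> maxnorm x \<le> R"
  unfolding maxnorm_def by (subst Max_le_iff) auto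

lemma component_large:
  fixes x :: "real^'n::finite"
  assumes "x \<notin> cball 0 (real CARD('n) * R)"
  obtains i where "R < \<bar>x $ i\<bar>"
proof (rule ccontr)
  assume "\<not> thesis"
  then have "\<bar>x $ i\<bar> \<le> R" for i using that by (meson not_le)
  then have "(\<Sum>i\<in>UNIV. \<bar>x $ i\<bar>) \<le> real CARD('n) * R"
    using sum_bounded_above[of UNIV "\<lambda>i. \<bar>x $ i\<bar>" R] by simp
  then show False
    using assms norm_le_l1_cart[of x] by simp
qed

lemma integrable_psi_j:
  fixes \<psi>0 :: "real^'n::finite \<Rightarrow> real"
  assumes "psi0_admissible \<psi>0"
  shows "integrable lborel (psi_j \<psi>0 j)"
proof (rule integrable_continuous_compact_support)
  have "dpart [] \<psi>0 differentiable (at x)" for x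
    using assms unfolding psi0_admissible_def smooth_fun_def by blast
  then have c: "continuous_on UNIV \<psi>0"
    by (auto intro!: continuous_at_imp_continuous_on differentiable_imp_continuous_within)
  have c': "continuous_on UNIV (\<lambda>x. \<psi>0 (r *\<^sub>R x))" for r
    by (rule continuous_on_compose2[OF c]) (auto intro!: continuous_intros)
  show "continuous_on UNIV (psi_j \<psi>0 j)"
    unfolding psi_j_def[abs_def] using c c' by (cases "j = 0") (auto intro!: continuous_intros)
  show "psi_j \<psi>0 j x = 0" if x: "x \<notin> cball 0 (real CARD('n) * (3/2 * 2 ^ j))" for x
  proof -
    obtain i where i: "3/2 * 2 ^ j < \<bar>x $ i\<bar>" using component_large[OF x] .
    \<comment> \<open>The scalings that occur in \<open>psi_j\<close> are \<open>1 / 2 ^ j\<close>,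
      \<open>2 / 2 ^ j\<close> and, for \<open>j = 0\<close>, 1.\<close>
    have "3/2 \<le> maxnorm (r *\<^sub>R x)" if "1 / 2 ^ j \<le> r" for r
    proof -
      have r: "0 \<le> r" using that by (rule order_trans[rotated]) simp
      have "(3/2 :: real) = 1 / 2 ^ j * (3/2 * 2 ^ j)" by simp
      also have "\<dots> \<le> r * \<bar>x $ i\<bar>"
        using i that r by (intro mult_mono) auto
      also have "\<dots> \<le> \<bar>(r *\<^sub>R x) $ i\<bar>"
        by (simp add: abs_mult mult_right_mono)
      finally show ?thesis using abs_le_maxnorm[of "r *\<^sub>R x" i] by simp
    qed
    from this[of "1 / 2 ^ j"] this[of "2 / 2 ^ j"] this[of 1]
    show ?thesis
      using assms by (auto simp: psi_j_def psi0_admissible_def divide_right_mono)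
  qed
qed auto

lemma integrable_phi_k:
  fixes k :: "'n::finite \<Rightarrow> nat"
  assumes "phi0_admissible \<phi>0"
  shows "integrable lborel (phi_k \<phi>0 k)"
proof (rule integrable_continuous_compact_support)
  have "(deriv ^^ 0) \<phi>0 differentiable (at x)" for x
    using assms unfolding phi0_admissible_def by blast
  then have c: "continuous_on UNIV \<phi>0"
    by (auto intro!: continuous_at_imp_continuous_on differentiable_imp_continuous_within)
  have c': "continuous_on UNIV (\<lambda>x::real^'n. phi_j \<phi>0 j (x $ i))" for i j
    unfolding phi_j_def[abs_def]
    by (cases "j = 0") (auto intro!: continuous_intros continuous_on_compose2[OF c])
  show "continuous_on UNIV (phi_k \<phi>0 k)"
    unfolding phi_k_def[abs_def] by (intro continuous_on_prod c')
  \<comment> \<open>The sum of the radii of all coordinates serves as a common radius.\<close>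
  show "phi_k \<phi>0 k x = 0" if x: "x \<notin> cball 0 (real CARD('n) * (\<Sum>i\<in>UNIV. 3/2 * 2 ^ k i))" for x
  proof -
    obtain i where i: "(\<Sum>i\<in>UNIV. 3/2 * 2 ^ k i) < \<bar>x $ i\<bar>" using component_large[OF x] .
    have "3/2 * 2 ^ k i \<le> (\<Sum>i\<in>UNIV. 3/2 * 2 ^ k i :: real)"
      by (rule member_le_sum) auto
    then have 1: "3/2 * 2 ^ k i < \<bar>x $ i\<bar>" using i by linarith
    then have "3/2 < \<bar>x $ i / 2 ^ k i\<bar>" "3/2 < \<bar>2 * x $ i / 2 ^ k i\<bar>"
      by (simp_all add: abs_divide field_simps)
    then have "phi_j \<phi>0 (k i) (x $ i) = 0"
      using assms by (auto simp: phi_j_def phi0_admissible_def)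
    then show ?thesis unfolding phi_k_def by (intro prod_zero) auto
  qed
qed auto

section \<open>Test frequencies and the blocks that contain them\<close>

definition freq :: "'n \<Rightarrow> 'n \<Rightarrow> nat \<Rightarrow> nat \<Rightarrow> 'n \<Rightarrow> real" where
  "freq a b N l i = (if i = a then 7 * 2 ^ N else if i = b then 7 * 2 ^ l else 0)"

text \<open>The unit neighbourhood of \<open>7 * 2 ^ m\<close> lies between \<open>3/4\<close> and \<open>1\<close> times
  \<open>2 ^ (m + 3)\<close>, where the block of index \<open>m + 3\<close> equals 1 and all others vanish.\<close>

definition level :: "'n \<Rightarrow> 'n \<Rightarrow> nat \<Rightarrow> nat \<Rightarrow> 'n \<Rightarrow> nat" where
  "level a b N l i = (if i = a then N + 3 else if i = b then l + 3 else 0)"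

lemma phi_j_window:
  assumes "phi0_admissible \<phi>0" and m: "1 \<le> m" and t: "\<bar>t - 7 * 2 ^ m\<bar> \<le> 1"
  shows "phi_j \<phi>0 j t = (if j = m + 3 then 1 else 0)"
proof -
  have one: "\<phi>0 u = 1" if "\<bar>u\<bar> \<le> 1" for u using assms(1) that by (simp add: phi0_admissible_def)
  have zero: "\<phi>0 u = 0" if "3/2 < \<bar>u\<bar>" for u using assms(1) that by (simp add: phi0_admissible_def)
  \<comment> \<open>With \<open>m \<ge> 1\<close> the half-width 1 is smaller than
    \<open>2 ^ m\<close>, so \<open>t\<close> stays strictly between \<open>6 * 2 ^ m\<close> and
    \<open>8 * 2 ^ m\<close>.\<close>
  have "(2::real) ^ 1 \<le> 2 ^ m" using m by (intro power_increasing) auto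
  then have t1: "6 * 2 ^ m < t" and t2: "t < 8 * 2 ^ m" and t0: "0 < t" using t by auto
  have lo: "3/2 < \<bar>t / 2 ^ i\<bar>" if "i \<le> m + 2" for i
  proof -
    have "(2::real) ^ i \<le> 2 ^ (m + 2)" using that by (intro power_increasing) auto
    then have "3/2 * 2 ^ i < t" using t1 by (simp add: power_add)
    then show ?thesis using t0 by (simp add: field_simps)
  qed
  have hi: "\<bar>t / 2 ^ i\<bar> \<le> 1" if "m + 3 \<le> i" for i
  proof -
    have "(2::real) ^ (m + 3) \<le> 2 ^ i" using that by (intro power_increasing) auto
    then have "t \<le> 2 ^ i" using t2 by (simp add: power_add)
    then show ?thesis using t0 by (simp add: field_simps)
  qed
  show ?thesis
  proof (cases j)
    case 0
    then show ?thesis using zero[OF lo[of 0]] by (simp add: phi_j_def)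
  next
    case (Suc i)
    have j: "phi_j \<phi>0 j t = \<phi>0 (t / 2 ^ j) - \<phi>0 (t / 2 ^ i)"
      using Suc by (simp add: phi_j_def)
    \<comment> \<open>The dilates of \<open>\<phi>0\<close> at \<open>t\<close> are 0 up to scale
      \<open>m + 2\<close> and 1 from scale \<open>m + 3\<close> on, so consecutive ones differ
      exactly once.\<close>
    consider "j \<le> m + 2" | "j = m + 3" | "m + 4 \<le> j" by linarith
    then show ?thesis
    proof cases
      case 1 then show ?thesis using zero[OF lo[of j]] zero[OF lo[of i]] j Suc by simp
    next
      case 2 then show ?thesis using one[OF hi[of j]] zero[OF lo[of i]] j Suc by simp
    next
      case 3 then show ?thesis using one[OF hi[of j]] one[OF hi[of i]] j Suc by simp
    qed
  qed
qed

lemma phi_j_near_0: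
  assumes "phi0_admissible \<phi>0" and t: "\<bar>t\<bar> \<le> 1"
  shows "phi_j \<phi>0 j t = (if j = 0 then 1 else 0)"
proof (cases j)
  case 0
  then show ?thesis using assms by (simp add: phi_j_def phi0_admissible_def)
next
  case (Suc i)
  have "\<phi>0 (t / 2 ^ k) = 1" for k
  proof -
    have "\<bar>t\<bar> \<le> 2 ^ k" using t one_le_power[of "2::real" k] by linarith
    then have "\<bar>t / 2 ^ k\<bar> \<le> 1" by (simp add: abs_divide)
    then show ?thesis using assms by (simp add: phi0_admissible_def)
  qed
  from this[of j] this[of i] show ?thesis using Suc by (simp add: phi_j_def)
qed

lemma phi_k_level:
  fixes \<zeta> :: "real^'n::finite"
  assumes "phi0_admissible \<phi>0" and l: "1 \<le> l" "l \<le> N"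
    and z: "\<And>i. \<bar>\<zeta> $ i - freq a b N l i\<bar> \<le> 1"
  shows "phi_k \<phi>0 k \<zeta> = (if k = level a b N l then 1 else 0)"
proof -
  have "phi_j \<phi>0 (k i) (\<zeta> $ i) = (if k i = level a b N l i then 1 else 0)" for i
    using phi_j_window[OF assms(1), of N "\<zeta> $ i"] phi_j_window[OF assms(1), of l "\<zeta> $ i"]
      phi_j_near_0[OF assms(1), of "\<zeta> $ i"] z[of i] l
    by (auto simp: freq_def level_def)
  then have eq: "phi_k \<phi>0 k \<zeta> = (\<Prod>i\<in>UNIV. if k i = level a b N l i then 1 else 0)"
    by (simp add: phi_k_def)
  show ?thesis
  proof (cases "k = level a b N l")
    case False
    then obtain i where "k i \<noteq> level a b N l i" by auto
    then show ?thesis unfolding eq using False by (auto intro!: prod_zero)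
  qed (unfold eq, simp)
qed

text \<open>All coordinates are at most \<open>8 * 2 ^ N\<close> in modulus, so the outer cutoff is
  1; coordinate \<open>a\<close> is at least \<open>6 * 2 ^ N\<close>, so the inner cutoff is 0.
  Neither bound depends on \<open>l\<close>.\<close>

lemma psi_j_level:
  fixes \<zeta> :: "real^'n::finite"
  assumes "psi0_admissible \<psi>0" and l: "1 \<le> l" "l \<le> N"
    and z: "\<And>i. \<bar>\<zeta> $ i - freq a b N l i\<bar> \<le> 1"
  shows "psi_j \<psi>0 (N + 3) \<zeta> = 1"
proof -
  have N: "(2::real) ^ 1 \<le> 2 ^ N" using l by (intro power_increasing) auto
  have hi: "\<bar>\<zeta> $ i\<bar> \<le> 8 * 2 ^ N" for i
  proof -
    have "0 \<le> freq a b N l i" "freq a b N l i \<le> 7 * 2 ^ N"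
      using l by (auto simp: freq_def)
    then show ?thesis using z[of i] N by (simp add: abs_le_iff)
  qed
  have "\<bar>\<zeta> $ a - 7 * 2 ^ N\<bar> \<le> 1" using z[of a] by (simp add: freq_def)
  then have lo: "6 * 2 ^ N \<le> \<bar>\<zeta> $ a\<bar>"
    using N by auto
  have "maxnorm ((1 / 2 ^ (N + 3)) *\<^sub>R \<zeta>) \<le> 1"
    by (rule maxnorm_le) (use hi in \<open>simp add: abs_divide power_add field_simps\<close>)
  moreover have "3/2 \<le> maxnorm ((2 / 2 ^ (N + 3)) *\<^sub>R \<zeta>)"
    by (rule order_trans[OF _ abs_le_maxnorm[of _ a]])
      (use lo in \<open>simp add: abs_mult power_add field_simps\<close>)
  ultimately show ?thesis
    using assms(1) by (simp add: psi_j_def psi0_admissible_def)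
qed

section \<open>Packets under the dyadic multipliers\<close>

definition packet :: "nat \<Rightarrow> 'n::finite \<Rightarrow> 'n \<Rightarrow> nat \<Rightarrow> (nat \<Rightarrow> real) \<Rightarrow> nat \<Rightarrow> real^'n \<Rightarrow> complex" where
  "packet K a b N s l y = (\<Prod>i\<in>UNIV. wave_packet K (if i = b then s l else 0) (freq a b N l i) (y $ i))"

definition packet_sum :: "nat \<Rightarrow> 'n::finite \<Rightarrow> 'n \<Rightarrow> nat \<Rightarrow> (nat \<Rightarrow> real) \<Rightarrow> real^'n \<Rightarrow> complex" where
  "packet_sum K a b N s y = (\<Sum>l\<in>{1..N}. packet K a b N s l y)"

lemma continuous_on_packet_sum: "continuous_on UNIV (packet_sum K a b N s)"
  unfolding packet_sum_def[abs_def] packet_def by (intro continuous_intros)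

lemma integrable_packet:
  "2 \<le> K \<Longrightarrow> integrable lborel (packet K a b N s l)"
  unfolding packet_def[abs_def] by (intro integrable_prod_vec integrable_wave_packet)

text \<open>Covers both decompositions: a \<open>psi_j\<close> that equals 1 on every box, and a
  \<open>phi_k\<close> that equals 1 on at most one box and 0 on the others.\<close>

lemma fmult_packet_sum:
  fixes c :: "real^'n::finite \<Rightarrow> real"
  assumes K: "2 \<le> K" and c: "integrable lborel c"
    and box: "\<And>l \<zeta>. l \<in> {1..N} \<Longrightarrow> (\<And>i. \<bar>\<zeta> $ i - freq a b N l i\<bar> \<le> 1) \<Longrightarrow> c \<zeta> = \<kappa> l"
  shows "fmult c (regular_distribution (packet_sum K a b N s)) x
    = (\<Sum>l\<in>{1..N}. complex_of_real (\<kappa> l) * packet K a b N s l x)"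
proof -
  have *: "integrable lborel (\<lambda>y. packet K a b N s l y * mkernel c (x - y)) \<and>
      (LINT y|lborel. packet K a b N s l y * mkernel c (x - y)) = complex_of_real (\<kappa> l) * packet K a b N s l x"
    if l: "l \<in> {1..N}" for l
  proof -
    have supp: "c \<zeta> = \<kappa> l"
      if "\<And>i. fourier (wave_packet K (if i = b then s l else 0) (freq a b N l i)) (\<zeta> $ i) \<noteq> 0" for \<zeta>
      using that fourier_wave_packet_eq_0[OF K] by (intro box[OF l]) (meson not_le)
    show ?thesis
      unfolding packet_def
      by (intro conjI integrable_mult_mkernel[where \<kappa>="\<kappa> l"] integral_mult_mkernel supp c K
          integrable_wave_packet integrable_fourier_wave_packet fourier_inversion_wave_packet) auto
  qed
  \<comment> \<open>\<open>regular_distribution\<close> is the same integral for every argument, so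
    it can be evaluated at the kernel directly.\<close>
  have "fmult c (regular_distribution (packet_sum K a b N s)) x
      = (LINT y|lborel. (\<Sum>l\<in>{1..N}. packet K a b N s l y * mkernel c (x - y)))"
    by (simp add: fmult_def regular_distribution_def packet_sum_def sum_distrib_right)
  also have "\<dots> = (\<Sum>l\<in>{1..N}. LINT y|lborel. packet K a b N s l y * mkernel c (x - y))"
    by (rule Bochner_Integration.integral_sum) (use * in blast)
  also have "\<dots> = (\<Sum>l\<in>{1..N}. complex_of_real (\<kappa> l) * packet K a b N s l x)"
    by (rule sum.cong) (use * in auto)
  finally show ?thesis .
qed

lemma fmult_psi_packet_sum:
  assumes "2 \<le> K" and "psi0_admissible \<psi>0"
  shows "fmult (psi_j \<psi>0 (N + 3)) (regular_distribution (packet_sum K a b N s)) = packet_sum K a b N s"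
proof
  fix x
  have "fmult (psi_j \<psi>0 (N + 3)) (regular_distribution (packet_sum K a b N s)) x
      = (\<Sum>l\<in>{1..N}. complex_of_real 1 * packet K a b N s l x)"
    by (rule fmult_packet_sum[OF assms(1) integrable_psi_j[OF assms(2)]], rule psi_j_level[OF assms(2)])
      auto
  then show "fmult (psi_j \<psi>0 (N + 3)) (regular_distribution (packet_sum K a b N s)) x
      = packet_sum K a b N s x"
    by (simp add: packet_sum_def)
qed

lemma fmult_phi_packet_sum:
  assumes "2 \<le> K" and "phi0_admissible \<phi>0" and ab: "a \<noteq> b"
  shows "l \<in> {1..N} \<Longrightarrow> fmult (phi_k \<phi>0 (level a b N l)) (regular_distribution (packet_sum K a b N s))
      = packet K a b N s l"
    and "k \<notin> level a b N ` {1..N} \<Longrightarrow> fmult (phi_k \<phi>0 k) (regular_distribution (packet_sum K a b N s))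
      = (\<lambda>_. 0)"
proof -
  have *: "fmult (phi_k \<phi>0 k) (regular_distribution (packet_sum K a b N s)) x
      = (\<Sum>l\<in>{1..N}. complex_of_real (if k = level a b N l then 1 else 0) * packet K a b N s l x)" for k x
    by (rule fmult_packet_sum[OF assms(1) integrable_phi_k[OF assms(2)]], rule phi_k_level[OF assms(2)])
      auto
  have inj: "level a b N l = level a b N m \<longleftrightarrow> l = m" for l m
    using ab by (auto simp: level_def fun_eq_iff)
  show "fmult (phi_k \<phi>0 (level a b N l)) (regular_distribution (packet_sum K a b N s))
      = packet K a b N s l" if "l \<in> {1..N}"
    using that by (intro ext) (auto simp: * inj if_distrib[of complex_of_real] if_distrib[of "\<lambda>c. c * _"] cong: if_cong)
  show "fmult (phi_k \<phi>0 k) (regular_distribution (packet_sum K a b N s)) = (\<lambda>_. 0)"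
    if "k \<notin> level a b N ` {1..N}"
    using that by (intro ext) (auto simp: * intro!: sum.neutral)
qed

section \<open>Consequences of the embedding\<close>

definition lacunary_sum :: "nat \<Rightarrow> nat \<Rightarrow> (nat \<Rightarrow> real) \<Rightarrow> real \<Rightarrow> complex" where
  "lacunary_sum K N s t = (\<Sum>l\<in>{1..N}. wave_packet K (s l) (7 * 2 ^ l) t)"

lemma measurable_lacunary_sum[measurable]: "lacunary_sum K N s \<in> borel_measurable borel"
  unfolding lacunary_sum_def[abs_def] by measurable

lemma norm_packet: "norm (packet K a b N s l y) = (\<Prod>i\<in>UNIV. \<bar>wave K (y $ i - (if i = b then s l else 0))\<bar>)"
  unfolding packet_def by (simp add: norm_wave_packet flip: prod_norm)

text \<open>All packets share their factors outside coordinate \<open>b\<close>, which reduces the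
  sum to one dimension.\<close>

lemma packet_sum_eq:
  assumes "a \<noteq> b"
  shows "packet_sum K a b N s y
    = lacunary_sum K N s (y $ b) * (\<Prod>i\<in>UNIV - {b}. wave_packet K 0 (freq a b N 0 i) (y $ i))"
proof -
  have "packet K a b N s l y = wave_packet K (s l) (7 * 2 ^ l) (y $ b) *
      (\<Prod>i\<in>UNIV - {b}. wave_packet K 0 (freq a b N 0 i) (y $ i))" for l
  proof -
    \<comment> \<open>Away from \<open>b\<close> the frequency does not depend on \<open>l\<close>;
      the index 0 on the right is an arbitrary representative.\<close>
    have "(\<Prod>i\<in>UNIV - {b}. wave_packet K (if i = b then s l else 0) (freq a b N l i) (y $ i))
        = (\<Prod>i\<in>UNIV - {b}. wave_packet K 0 (freq a b N 0 i) (y $ i))"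
      by (rule prod.cong) (auto simp: freq_def)
    then show ?thesis
      unfolding packet_def using assms
      by (subst prod.remove[of _ b]) (auto simp: freq_def)
  qed
  then show ?thesis
    by (simp add: packet_sum_def lacunary_sum_def sum_distrib_right)
qed

section \<open>L_p norms of packets and of their sums\<close>

lemma Lp_norm_0: "Lp_norm p (\<lambda>_ :: real^'n::finite. 0) = 0"
proof (cases "p = top")
  case True
  have "esssup (lborel :: (real^'n) measure) (\<lambda>x. ereal 0) = ereal 0"
    by (rule esssup_const) simp
  then show ?thesis using True by (simp add: Lp_norm_def e2ennreal_ereal)
next
  case False
  then show ?thesis by (simp add: Lp_norm_def epow_def)
qed

lemma Lp_norm_top_le:
  assumes [measurable]: "f \<in> borel_measurable borel" and "\<And>x. norm (f x) \<le> A"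
  shows "Lp_norm top f \<le> ennreal A"
proof -
  have "esssup lborel (\<lambda>x. ereal (norm (f x))) \<le> ereal A"
    by (rule esssup_I) (use assms in auto)
  then have "e2ennreal (esssup lborel (\<lambda>x. ereal (norm (f x)))) \<le> e2ennreal (ereal A)"
    by (rule e2ennreal_mono)
  then show ?thesis by (simp add: Lp_norm_def ennreal.abs_eq e2ennreal_ereal)
qed

text \<open>By continuity the set where the norm exceeds the essential supremum is open; being null,
  it is empty.\<close>

lemma Lp_norm_top_ge:
  fixes f :: "real^'n::finite \<Rightarrow> complex"
  assumes "continuous_on UNIV f"
  shows "ennreal (norm (f x)) \<le> Lp_norm top f"
proof -
  let ?S = "esssup lborel (\<lambda>x. ereal (norm (f x)))"
  have "ereal (norm (f x)) \<le> ?S"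
  proof (rule ccontr)
    assume "\<not> ereal (norm (f x)) \<le> ?S"
    then have x: "?S < ereal (norm (f x))" by simp
    let ?U = "{y. ?S < ereal (norm (f y))}"
    have "open ?U"
      by (rule open_Collect_less) (use assms in \<open>auto intro!: continuous_intros\<close>)
    have "emeasure lborel ?U = 0"
      using esssup_zero_measure[of lborel "\<lambda>x. ereal (norm (f x))"] by simp
    then have "?U \<in> null_sets lborel"
      using \<open>open ?U\<close> by auto
    then have "negligible ?U"
      by (simp add: negligible_iff_null_sets null_sets_completionI)
    with \<open>open ?U\<close> have "?U = {}"
      using open_not_negligible by blast
    with x show False by blast
  qed
  then show ?thesis
    unfolding Lp_norm_def by (simp add: ennreal.abs_eq e2ennreal_mono flip: e2ennreal_ereal)
qed

text \<open>The modulus forgets the modulation and Lebesgue measure forgets the shift, so the norm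
  is the same for all \<open>N\<close>, \<open>s\<close> and \<open>l\<close>. This supplies the
  uniform bound required of the packets.\<close>

lemma Lp_norm_packet:
  fixes a b :: "'n::finite"
  assumes p: "0 < p" "p \<noteq> top"
  shows "Lp_norm p (packet K a b N s l)
    = epow ((\<integral>\<^sup>+ t. ennreal (\<bar>wave K t\<bar> powr enn2real p) \<partial>lborel) ^ CARD('n)) (1 / enn2real p)"
proof -
  have "(\<integral>\<^sup>+ y. ennreal (norm (packet K a b N s l y) powr enn2real p) \<partial>lborel)
      = (\<integral>\<^sup>+ y. (\<Prod>i\<in>UNIV. ennreal (\<bar>wave K (y $ i - (if i = b then s l else 0))\<bar> powr enn2real p)) \<partial>lborel)"
    by (simp add: norm_packet prod_powr_distrib prod_ennreal)
  also have "\<dots> = (\<Prod>i\<in>UNIV. \<integral>\<^sup>+ t. ennreal (\<bar>wave K (t - (if i = b then s l else 0))\<bar> powr enn2real p) \<partial>lborel)"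
    by (rule nn_integral_prod_vec) measurable
  also have "\<dots> = (\<Prod>i\<in>(UNIV::'n set). \<integral>\<^sup>+ t. ennreal (\<bar>wave K t\<bar> powr enn2real p) \<partial>lborel)"
  proof (rule prod.cong[OF refl])
    fix i :: 'n
    have "(\<integral>\<^sup>+ t. ennreal (\<bar>wave K t\<bar> powr enn2real p) \<partial>lborel)
      = ennreal \<bar>1\<bar> * (\<integral>\<^sup>+ t. ennreal (\<bar>wave K (- (if i = b then s l else 0) + 1 * t)\<bar> powr enn2real p) \<partial>lborel)"
      by (rule nn_integral_real_affine) auto
    then show "(\<integral>\<^sup>+ t. ennreal (\<bar>wave K (t - (if i = b then s l else 0))\<bar> powr enn2real p) \<partial>lborel)
      = (\<integral>\<^sup>+ t. ennreal (\<bar>wave K t\<bar> powr enn2real p) \<partial>lborel)"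
      by simp
  qed
  finally show ?thesis
    using p by (simp add: Lp_norm_def prod_constant)
qed

lemma Lp_norm_packet_sum:
  fixes a b :: "'n::finite"
  assumes p: "0 < p" "p \<noteq> top" and ab: "a \<noteq> b"
  shows "Lp_norm p (packet_sum K a b N s)
    = epow ((\<integral>\<^sup>+ t. ennreal (norm (lacunary_sum K N s t) powr enn2real p) \<partial>lborel)
        * (\<integral>\<^sup>+ t. ennreal (\<bar>wave K t\<bar> powr enn2real p) \<partial>lborel) ^ (CARD('n) - 1)) (1 / enn2real p)"
proof -
  define u where "u i t = (if i = b then ennreal (norm (lacunary_sum K N s t) powr enn2real p)
      else ennreal (\<bar>wave K t\<bar> powr enn2real p))" for i t
  have [measurable]: "u i \<in> borel_measurable borel" for i
    unfolding u_def by measurable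
  have "ennreal (norm (packet_sum K a b N s y) powr enn2real p) = (\<Prod>i\<in>UNIV. u i (y $ i))" for y
  proof -
    have "norm (packet_sum K a b N s y) powr enn2real p
        = norm (lacunary_sum K N s (y $ b)) powr enn2real p * (\<Prod>i\<in>UNIV - {b}. \<bar>wave K (y $ i)\<bar> powr enn2real p)"
      unfolding packet_sum_eq[OF ab] norm_mult
      by (simp add: powr_mult prod_nonneg norm_wave_packet prod_powr_distrib flip: prod_norm)
    also have "ennreal \<dots> = u b (y $ b) * (\<Prod>i\<in>UNIV - {b}. u i (y $ i))"
      by (simp add: u_def ennreal_mult prod_nonneg flip: prod_ennreal)
    also have "\<dots> = (\<Prod>i\<in>UNIV. u i (y $ i))"
      by (rule prod.remove[symmetric]) auto
    finally show ?thesis .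
  qed
  then have "(\<integral>\<^sup>+ y. ennreal (norm (packet_sum K a b N s y) powr enn2real p) \<partial>lborel)
      = (\<Prod>i\<in>UNIV. \<integral>\<^sup>+ t. u i t \<partial>lborel)"
    by (simp add: nn_integral_prod_vec)
  also have "\<dots> = (\<integral>\<^sup>+ t. u b t \<partial>lborel) * (\<Prod>i\<in>UNIV - {b}. \<integral>\<^sup>+ t. u i t \<partial>lborel)"
    by (rule prod.remove) auto
  also have "(\<Prod>i\<in>UNIV - {b}. \<integral>\<^sup>+ t. u i t \<partial>lborel)
      = (\<integral>\<^sup>+ t. ennreal (\<bar>wave K t\<bar> powr enn2real p) \<partial>lborel) ^ (CARD('n) - 1)"
    by (simp add: u_def prod_constant card_Diff_singleton)
  finally show ?thesis
    using p by (simp add: Lp_norm_def u_def)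
qed

text \<open>The mixed norm sees one packet in each of at most \<open>N\<close> blocks, whereas the
  single Besov block \<open>N + 3\<close> contains the entire sum.\<close>

lemma embedding_packet_sum_bound:
  fixes \<psi>0 :: "real^'n::finite \<Rightarrow> real" and a b :: 'n
  assumes adm: "psi0_admissible \<psi>0" "phi0_admissible \<phi>0" and q: "0 < q"
    and emb: "mixed_embeds_besov \<phi>0 \<psi>0 0 p q"
    and K: "2 \<le> K" and ab: "a \<noteq> b"
    and A: "0 \<le> A" "\<And>N s l. Lp_norm p (packet K a b N s l) \<le> ennreal A"
  obtains C where "0 \<le> C" "\<And>N s. 1 \<le> N \<Longrightarrow>
    Lp_norm p (packet_sum K a b N s) \<le> ennreal (C * real N powr (1 / enn2real q))"
proof -
  from emb obtain C where C: "\<And>T. tempered T \<Longrightarrow> mixed_norm \<phi>0 0 p q T < top \<Longrightarrow>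
      besov_norm \<psi>0 0 p q T \<le> ennreal C * mixed_norm \<phi>0 0 p q T"
    unfolding mixed_embeds_besov_def by blast
  show thesis
  \<comment> \<open>The embedding constant is an arbitrary real; \<open>max C 0\<close> makes it
    nonnegative without changing its value under \<open>ennreal\<close>.\<close>
  proof (rule that[of "max C 0 * A"])
    fix N :: nat and s assume N: "1 \<le> N"
    let ?T = "regular_distribution (packet_sum K a b N s)"
    let ?L = "level a b N ` {1..N}"
    have T: "tempered ?T"
      unfolding packet_sum_def[abs_def]
      by (intro tempered_regular_distribution Bochner_Integration.integrable_sum integrable_packet K)
    have "mixed_norm \<phi>0 0 p q ?T \<le> ennreal (real (card ?L) powr (1 / enn2real q) * A)"
      unfolding mixed_norm_def
    proof (rule lq_norm_finite_support_le[OF q])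
      fix k :: "'n \<Rightarrow> nat"
      show "k \<notin> ?L \<Longrightarrow> ennreal (2 powr (real (sum k UNIV) * 0)) * Lp_norm p (fmult (phi_k \<phi>0 k) ?T) = 0"
        using fmult_phi_packet_sum(2)[OF K adm(2) ab] by (simp add: Lp_norm_0)
      then show "ennreal (2 powr (real (sum k UNIV) * 0)) * Lp_norm p (fmult (phi_k \<phi>0 k) ?T) \<le> ennreal A"
        using fmult_phi_packet_sum(1)[OF K adm(2) ab] A(2) by (cases "k \<in> ?L") auto
    qed (use N A in auto)
    also have "\<dots> \<le> ennreal (real N powr (1 / enn2real q) * A)"
      using A(1) card_image_le[of "{1..N}" "level a b N"]
      by (intro ennreal_leI mult_right_mono powr_mono2) auto
    finally have m: "mixed_norm \<phi>0 0 p q ?T \<le> ennreal (real N powr (1 / enn2real q) * A)" .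
    \<comment> \<open>Finiteness of the mixed norm is a premise of the embedding inequality.\<close>
    then have fin: "mixed_norm \<phi>0 0 p q ?T < top"
      using ennreal_less_top by (rule order_le_less_trans)
    have "Lp_norm p (packet_sum K a b N s)
        = ennreal (2 powr (real (N + 3) * 0)) * Lp_norm p (fmult (psi_j \<psi>0 (N + 3)) ?T)"
      by (simp add: fmult_psi_packet_sum[OF K adm(1)])
    also have "\<dots> \<le> besov_norm \<psi>0 0 p q ?T"
      unfolding besov_norm_def by (rule lq_norm_ge[OF q])
    also have "\<dots> \<le> ennreal C * mixed_norm \<phi>0 0 p q ?T"
      by (rule C[OF T fin])
    also have "\<dots> \<le> ennreal (max C 0) * ennreal (real N powr (1 / enn2real q) * A)"
      using m by (intro mult_mono ennreal_leI) auto
    also have "\<dots> = ennreal (max C 0 * A * real N powr (1 / enn2real q))"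
      using A(1) by (simp add: mult_ac flip: ennreal_mult)
    finally show "Lp_norm p (packet_sum K a b N s) \<le> ennreal (max C 0 * A * real N powr (1 / enn2real q))" .
  qed (use A in auto)
qed

text \<open>The coordinates other than \<open>b\<close> contribute a fixed power of
  \<open>J\<close>, which is finite by the choice of \<open>K\<close> and positive by
  \<open>wave_lower_bound\<close>; it is divided out after raising to the power
  \<open>p\<close>.\<close>

lemma embedding_lacunary_sum_bound:
  fixes \<psi>0 :: "real^'n::finite \<Rightarrow> real" and a b :: 'n
  assumes adm: "psi0_admissible \<psi>0" "phi0_admissible \<phi>0" and q: "0 < q"
    and emb: "mixed_embeds_besov \<phi>0 \<psi>0 0 p q"
    and p: "0 < p" "p \<noteq> top"
    and K: "2 \<le> K" "2 \<le> real K * enn2real p" and ab: "a \<noteq> b"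
  obtains C where "0 \<le> C" "\<And>N s. 1 \<le> N \<Longrightarrow>
    (\<integral>\<^sup>+ t. ennreal (norm (lacunary_sum K N s t) powr enn2real p) \<partial>lborel)
      \<le> ennreal (C * real N powr (enn2real p / enn2real q))"
proof -
  define r where "r = enn2real p"
  have r: "0 < r" using p by (simp add: r_def enn2real_positive_iff less_top)
  define J where "J = (LINT t|lborel. \<bar>wave K t\<bar> powr r)"
  have int: "integrable lborel (\<lambda>t. \<bar>wave K t\<bar> powr r)"
    using K by (intro integrable_wave_powr) (auto simp: r_def)
  have J: "(\<integral>\<^sup>+ t. ennreal (\<bar>wave K t\<bar> powr r) \<partial>lborel) = ennreal J"
    unfolding J_def by (rule nn_integral_eq_integral[OF int]) auto
  have J0: "0 < J"
  proof -
    obtain c where c: "0 < c" "\<And>t. t \<in> {-pi..pi} \<Longrightarrow> c \<le> wave K t"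
      using wave_lower_bound[OF K(1)] by blast
    have "ennreal 0 < ennreal (c powr r * (2 * pi))"
      using c(1) by (intro ennreal_lessI) auto
    also have "\<dots> = (\<integral>\<^sup>+ t. ennreal (c powr r) * indicator {-pi..pi} t \<partial>lborel)"
      by (subst nn_integral_cmult_indicator) (auto simp: ennreal_mult)
    also have "\<dots> \<le> (\<integral>\<^sup>+ t. ennreal (\<bar>wave K t\<bar> powr r) \<partial>lborel)"
    proof (rule nn_integral_mono)
      fix t :: real
      show "ennreal (c powr r) * indicator {-pi..pi} t \<le> ennreal (\<bar>wave K t\<bar> powr r)"
        using c(1) c(2)[of t] r by (auto simp: indicator_def intro!: ennreal_leI powr_mono2)
    qed
    finally show ?thesis unfolding J by simp
  qed
  let ?A = "(J ^ CARD('n)) powr (1 / r)"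
  have A: "Lp_norm p (packet K a b N s l) \<le> ennreal ?A" for N s l
    using J J0 p by (simp add: Lp_norm_packet ennreal_power epow_ennreal flip: r_def)
  obtain C where C: "0 \<le> C" "\<And>N s. 1 \<le> N \<Longrightarrow>
      Lp_norm p (packet_sum K a b N s) \<le> ennreal (C * real N powr (1 / enn2real q))"
    by (rule embedding_packet_sum_bound[OF adm q emb K(1) ab powr_ge_zero A]) blast
  let ?J' = "J ^ (CARD('n) - 1)"
  show thesis
  proof (rule that[of "C powr r / ?J'"])
    fix N :: nat and s assume N: "1 \<le> N"
    define X where "X = (\<integral>\<^sup>+ t. ennreal (norm (lacunary_sum K N s t) powr enn2real p) \<partial>lborel)"
    have "epow (X * ennreal ?J') (1 / r) \<le> ennreal (C * real N powr (1 / enn2real q))"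
      using C(2)[OF N, of s] Lp_norm_packet_sum[OF p ab, of K N s] J0
      by (simp add: X_def J ennreal_power flip: r_def)
    \<comment> \<open>The exponent \<open>1 / (1 / r)\<close> has the shape in which
      \<open>epow_epow_inverse\<close> undoes the root.\<close>
    then have "epow (epow (X * ennreal ?J') (1 / r)) (1 / (1 / r))
        \<le> epow (ennreal (C * real N powr (1 / enn2real q))) (1 / (1 / r))"
      using r by (intro epow_mono) auto
    then have 1: "X * ennreal ?J' \<le> ennreal (C powr r * real N powr (r / enn2real q))"
      using r C(1) epow_epow_inverse[of "1 / r"] by (simp add: epow_ennreal powr_mult powr_powr)
    then have "X * ennreal ?J' * ennreal (1 / ?J') \<le> ennreal (C powr r * real N powr (r / enn2real q)) * ennreal (1 / ?J')"
      by (rule mult_right_mono) simp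
    then have "X \<le> ennreal (C powr r / ?J' * real N powr (r / enn2real q))"
      using J0 by (simp add: mult.assoc flip: ennreal_mult)
    then show "(\<integral>\<^sup>+ t. ennreal (norm (lacunary_sum K N s t) powr enn2real p) \<partial>lborel)
      \<le> ennreal (C powr r / ?J' * real N powr (enn2real p / enn2real q))"
      by (simp only: X_def r_def)
  qed (use J0 in auto)
qed

lemma powr_growth_le:
  fixes \<alpha> \<beta> \<delta> C :: real
  assumes \<delta>: "0 < \<delta>" and le: "\<And>N::nat. 1 \<le> N \<Longrightarrow> \<delta> * real N powr \<alpha> \<le> C * real N powr \<beta>"
  shows "\<alpha> \<le> \<beta>"
proof (rule ccontr)
  assume "\<not> \<alpha> \<le> \<beta>"
  then have "0 < \<alpha> - \<beta>" by simp
  then have "filterlim (\<lambda>N::nat. real N powr (\<alpha> - \<beta>)) at_top sequentially"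
    by real_asymp
  then have "\<forall>\<^sub>F N in sequentially. C / \<delta> + 1 \<le> real N powr (\<alpha> - \<beta>)"
    by (simp add: filterlim_at_top)
  then obtain N where N: "1 \<le> N" "C / \<delta> + 1 \<le> real N powr (\<alpha> - \<beta>)"
    using eventually_conj[OF _ eventually_ge_at_top[of 1], of "\<lambda>N. C / \<delta> + 1 \<le> real N powr (\<alpha> - \<beta>)"]
    by (auto simp: eventually_sequentially)
  have "\<delta> * real N powr (\<alpha> - \<beta>) \<le> C"
    using le[OF N(1)] N(1) by (simp add: powr_diff field_simps)
  then have "real N powr (\<alpha> - \<beta>) \<le> C / \<delta>"
    using \<delta> by (simp add: field_simps)
  with N(2) show False by simp
qed

section \<open>Lower bounds for lacunary sums\<close>

text \<open>If one side has both exponents below some exponent of the other, it is at most that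
  single power of 2 and hence strictly smaller. So the maximal exponents agree, and cancelling them
  leaves the others equal.\<close>

lemma sum_two_powers_unique:
  assumes "(2::int) ^ a + 2 ^ b = 2 ^ c + 2 ^ d"
  shows "(a = c \<and> b = d) \<or> (a = d \<and> b = c)"
proof -
  have gt: "(2::int) ^ x + 2 ^ y < 2 ^ z + 2 ^ w" if "x < z" "y < z" for x y z w :: nat
  proof -
    have "(2::int) ^ Suc x \<le> 2 ^ z" "(2::int) ^ Suc y \<le> 2 ^ z"
      using that by (intro power_increasing; simp)+
    moreover have "(0::int) < 2 ^ w" by simp
    ultimately show ?thesis unfolding power_Suc by linarith
  qed
  have "max a b = max c d"
  proof (rule ccontr)
    assume "max a b \<noteq> max c d"
    then have "max a b < max c d \<or> max c d < max a b" by linarith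
    then consider "a < c \<and> b < c" | "a < d \<and> b < d" | "c < a \<and> d < a" | "c < b \<and> d < b"
      unfolding less_max_iff_disj max_less_iff_conj by blast
    then show False
      using gt[of a c b d] gt[of a d b c] gt[of c a d b] gt[of c b d a] assms by cases auto
  qed
  then have "a = c \<or> a = d \<or> b = c \<or> b = d" by (auto simp: max_def split: if_splits)
  then show ?thesis using assms by auto
qed

lemma integral_cis_period:
  fixes k :: int
  shows "(LINT t|lborel. indicator {-pi..pi} t *\<^sub>R cis (of_int k * t)) = (if k = 0 then complex_of_real (2 * pi) else 0)"
proof (cases "k = 0")
  case True
  have "(LINT t|lborel. indicator {-pi..pi} t *\<^sub>R (1::complex)) = measure lborel {-pi..pi} *\<^sub>R 1"
    by simp
  then show ?thesis using True by (simp add: scaleR_conv_of_real)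
next
  case False
  let ?F = "\<lambda>u. cis (of_int k * u) / (\<i> * of_int k)"
  have "(LINT u|lborel. indicator {-pi..pi} u *\<^sub>R (cis (of_int k * u))) = ?F pi - ?F (-pi)"
  proof (rule integral_FTC_atLeastAtMost)
    show "(?F has_vector_derivative cis (of_int k * u)) (at u within {-pi..pi})" for u
      unfolding cis_conv_exp using False
      by (auto intro!: derivative_eq_intros has_vector_derivative_real_field simp: field_simps)
  qed (auto intro!: continuous_intros)
  also have "\<dots> = 0"
    by (simp add: complex_eq_iff sin_zero_iff_int2 Re_divide Im_divide mult.commute)
  finally show ?thesis using False by simp
qed

definition lacunary_trig :: "nat \<Rightarrow> real \<Rightarrow> complex" where
  "lacunary_trig N t = (\<Sum>l\<in>{1..N}. cis (7 * 2 ^ l * t))"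

lemma continuous_on_lacunary_trig: "continuous_on S (lacunary_trig N)"
  unfolding lacunary_trig_def[abs_def] by (intro continuous_intros)

lemma integrable_cis_period: "integrable lborel (\<lambda>t. indicator {-pi..pi} t *\<^sub>R cis (x * t))"
  by (rule borel_integrable_compact) (auto intro!: continuous_intros)

text \<open>Orthogonality of the characters on a period leaves only the diagonal of the double
  sum.\<close>

lemma lacunary_trig_L2:
  "(LINT t|lborel. indicator {-pi..pi} t * (norm (lacunary_trig N t))\<^sup>2) = 2 * pi * real N"
proof -
  have sq: "complex_of_real ((norm (lacunary_trig N t))\<^sup>2)
      = (\<Sum>(l, m)\<in>{1..N} \<times> {1..N}. cis (of_int (7 * (2 ^ l - 2 ^ m)) * t))" for t
  proof -
    have "complex_of_real ((norm (lacunary_trig N t))\<^sup>2) = lacunary_trig N t * cnj (lacunary_trig N t)"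
      by (rule complex_norm_square)
    also have "\<dots> = (\<Sum>l\<in>{1..N}. \<Sum>m\<in>{1..N}. cis (7 * 2 ^ l * t) * cis (- (7 * 2 ^ m * t)))"
      by (simp add: lacunary_trig_def sum_product cis_cnj)
    also have "\<dots> = (\<Sum>(l, m)\<in>{1..N} \<times> {1..N}. cis (of_int (7 * (2 ^ l - 2 ^ m)) * t))"
      by (simp add: sum.cartesian_product cis_mult algebra_simps)
    finally show ?thesis .
  qed
  have "complex_of_real (LINT t|lborel. indicator {-pi..pi} t * (norm (lacunary_trig N t))\<^sup>2)
      = (LINT t|lborel. complex_of_real (indicator {-pi..pi} t * (norm (lacunary_trig N t))\<^sup>2))"
    by (rule integral_complex_of_real[symmetric])
  also have "\<dots> = (LINT t|lborel. (\<Sum>x\<in>{1..N} \<times> {1..N}.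
      indicator {-pi..pi} t *\<^sub>R cis (of_int (7 * (2 ^ fst x - 2 ^ snd x)) * t)))"
    unfolding of_real_mult sq
    by (rule Bochner_Integration.integral_cong) (auto simp: indicator_def case_prod_beta')
  also have "\<dots> = (\<Sum>x\<in>{1..N} \<times> {1..N}. (LINT t|lborel.
      indicator {-pi..pi} t *\<^sub>R cis (of_int (7 * (2 ^ fst x - 2 ^ snd x)) * t)))"
    by (rule Bochner_Integration.integral_sum) (rule integrable_cis_period)
  also have "\<dots> = (\<Sum>x\<in>{1..N} \<times> {1..N}. if fst x = snd x then complex_of_real (2 * pi) else 0)"
    unfolding integral_cis_period by (rule sum.cong) auto
  also have "\<dots> = (\<Sum>l\<in>{1..N}. \<Sum>m\<in>{1..N}. if l = m then complex_of_real (2 * pi) else 0)"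
    by (simp only: sum.cartesian_product case_prod_beta')
  also have "\<dots> = complex_of_real (2 * pi * real N)"
    by simp
  finally show ?thesis by (simp only: of_real_eq_iff)
qed

text \<open>The fourth moment is \<open>2 * pi\<close> times the number of additive coincidences
  among the frequencies. By \<open>sum_two_powers_unique\<close> only the trivial ones occur, at
  most \<open>2 * N^2\<close> of them.\<close>

lemma lacunary_trig_L4:
  "(LINT t|lborel. indicator {-pi..pi} t * (norm (lacunary_trig N t)) ^ 4) \<le> 4 * pi * (real N)\<^sup>2"
proof -
  let ?Q = "({1..N} \<times> {1..N}) \<times> ({1..N} \<times> {1..N})"
  \<comment> \<open>The frequency of each term of the fourfold sum, kept in \<open>int\<close> so
    that \<open>integral_cis_period\<close> applies.\<close>
  define h :: "(nat \<times> nat) \<times> nat \<times> nat \<Rightarrow> int"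
    where "h = (\<lambda>((a, b), c, d). 7 * ((2 ^ a + 2 ^ b) - (2 ^ c + 2 ^ d)))"
  have p4: "complex_of_real (norm (lacunary_trig N t) ^ 4) = (\<Sum>x\<in>?Q. cis (of_int (h x) * t))" for t
  proof -
    have sq: "lacunary_trig N t * lacunary_trig N t = (\<Sum>(a, b)\<in>{1..N} \<times> {1..N}. cis (7 * (2 ^ a + 2 ^ b) * t))"
      by (simp add: lacunary_trig_def sum_product sum.cartesian_product cis_mult algebra_simps)
    have "complex_of_real (norm (lacunary_trig N t) ^ 4) = (complex_of_real ((norm (lacunary_trig N t))\<^sup>2))\<^sup>2"
      by (simp flip: power_mult)
    also have "\<dots> = (lacunary_trig N t * lacunary_trig N t) * cnj (lacunary_trig N t * lacunary_trig N t)"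
      unfolding complex_norm_square by (simp add: power2_eq_square mult_ac)
    also have "\<dots> = (\<Sum>x\<in>?Q. cis (of_int (h x) * t))"
      unfolding sq
      by (simp add: sum_product sum.cartesian_product cis_cnj cis_mult case_prod_beta' h_def algebra_simps)
    finally show ?thesis .
  qed
  have "complex_of_real (LINT t|lborel. indicator {-pi..pi} t * norm (lacunary_trig N t) ^ 4)
      = (LINT t|lborel. complex_of_real (indicator {-pi..pi} t * norm (lacunary_trig N t) ^ 4))"
    by (rule integral_complex_of_real[symmetric])
  also have "\<dots> = (LINT t|lborel. (\<Sum>x\<in>?Q. indicator {-pi..pi} t *\<^sub>R cis (of_int (h x) * t)))"
    unfolding of_real_mult p4
    by (rule Bochner_Integration.integral_cong) (auto simp: indicator_def)
  also have "\<dots> = (\<Sum>x\<in>?Q. (LINT t|lborel. indicator {-pi..pi} t *\<^sub>R cis (of_int (h x) * t)))"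
    by (rule Bochner_Integration.integral_sum) (rule integrable_cis_period)
  also have "\<dots> = (\<Sum>x\<in>?Q. if h x = 0 then complex_of_real (2 * pi) else 0)"
    unfolding integral_cis_period ..
  also have "\<dots> = complex_of_real (2 * pi * real (card {x\<in>?Q. h x = 0}))"
    by (simp add: sum.inter_filter[symmetric] mult.commute)
  finally have eq: "(LINT t|lborel. indicator {-pi..pi} t * norm (lacunary_trig N t) ^ 4)
      = 2 * pi * real (card {x\<in>?Q. h x = 0})"
    by (simp only: of_real_eq_iff)
  have "{x\<in>?Q. h x = 0} \<subseteq> (\<lambda>(a, b). ((a, b), a, b)) ` ({1..N} \<times> {1..N})
      \<union> (\<lambda>(a, b). ((a, b), b, a)) ` ({1..N} \<times> {1..N})"
  proof
    fix x assume x: "x \<in> {x\<in>?Q. h x = 0}"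
    obtain a b c d where abcd: "x = ((a, b), c, d)" by (metis surj_pair)
    from x have "(2::int) ^ a + 2 ^ b = 2 ^ c + 2 ^ d" by (simp add: abcd h_def)
    from sum_two_powers_unique[OF this] x
    show "x \<in> (\<lambda>(a, b). ((a, b), a, b)) ` ({1..N} \<times> {1..N})
      \<union> (\<lambda>(a, b). ((a, b), b, a)) ` ({1..N} \<times> {1..N})"
      by (auto simp: abcd image_iff)
  qed
  then have "card {x\<in>?Q. h x = 0} \<le> card ((\<lambda>(a, b). ((a, b), a, b)) ` ({1..N} \<times> {1..N})
      \<union> (\<lambda>(a, b). ((a, b), b, a)) ` ({1..N} \<times> {1..N}))"
    by (rule card_mono[rotated]) auto
  also have "\<dots> \<le> card ((\<lambda>(a, b). ((a, b), a, b)) ` ({1..N} \<times> {1..N}))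
      + card ((\<lambda>(a, b). ((a, b), b, a)) ` ({1..N} \<times> {1..N}))"
    by (rule card_Un_le)
  also have "\<dots> \<le> card ({1..N} \<times> {1..N}) + card ({1..N} \<times> {1..N})"
    by (intro add_mono card_image_le) auto
  also have "\<dots> = 2 * N\<^sup>2" by (simp add: power2_eq_square)
  finally have "real (card {x\<in>?Q. h x = 0}) \<le> real (2 * N\<^sup>2)"
    by (simp only: of_nat_le_iff)
  then show ?thesis unfolding eq by (simp add: mult_left_mono)
qed

text \<open>Small \<open>u\<close> is absorbed by \<open>1/4\<close> and large \<open>u\<close> by
  the fourth power; in between \<open>u\<^sup>2\<close> is below 8 and \<open>(2 * u) powr p\<close>
  is at least 1. The weights \<open>1/4\<close> and \<open>1/8\<close> are small enough that, after
  integration, the second moment of the lacunary sum dominates both error terms.\<close>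

lemma square_le_powr_plus:
  fixes u p :: real
  assumes "0 \<le> u" "0 < p"
  shows "u\<^sup>2 \<le> 8 * 2 powr p * u powr p + 1/4 + u ^ 4 / 8"
proof -
  have n: "0 \<le> 8 * 2 powr p * u powr p" "0 \<le> u ^ 4 / 8" by auto
  consider "u \<le> 1/2" | "8 \<le> u\<^sup>2" | "1/2 < u" "u\<^sup>2 < 8" by linarith
  then show ?thesis
  proof cases
    case 1
    then have "u\<^sup>2 \<le> (1/2)\<^sup>2" using assms by (intro power_mono) auto
    also have "(1/2 :: real)\<^sup>2 = 1/4" by (simp add: power2_eq_square)
    finally show ?thesis using n by linarith
  next
    case 2
    then have "8 * u\<^sup>2 \<le> u\<^sup>2 * u\<^sup>2" by (intro mult_right_mono) auto
    also have "u\<^sup>2 * u\<^sup>2 = u ^ 4" by (simp flip: power_add)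
    finally show ?thesis using n by linarith
  next
    case 3
    have "1 \<le> (2 * u) powr p" using 3 assms by (intro ge_one_powr_ge_zero) auto
    then have "8 \<le> 8 * 2 powr p * u powr p" using assms by (simp add: powr_mult)
    then show ?thesis using 3 n by linarith
  qed
qed

text \<open>Integrate the preceding inequality for the normalised modulus
  \<open>u = norm (lacunary_trig N t) / sqrt N\<close>. The left side gives \<open>2 * pi\<close>,
  the constant and the fourth moment cost at most \<open>pi / 2\<close> each, and the p-th moment
  must supply the remaining \<open>pi\<close>.\<close>

lemma lacunary_trig_Lp:
  assumes p: "0 < p" and N: "1 \<le> N"
  shows "pi / (8 * 2 powr p) * real N powr (p / 2)
    \<le> (LINT t|lborel. indicator {-pi..pi} t * norm (lacunary_trig N t) powr p)"
proof -
  let ?S = "\<lambda>t. norm (lacunary_trig N t)"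
  have int: "integrable lborel (\<lambda>t. indicator {-pi..pi} t * f t)" if "continuous_on {-pi..pi} f" for f :: "real \<Rightarrow> real"
    using borel_integrable_compact[OF compact_Icc that] by simp
  have cS: "continuous_on S ?S" for S
    by (intro continuous_intros continuous_on_lacunary_trig)
  have i2: "integrable lborel (\<lambda>t. indicator {-pi..pi} t * (?S t)\<^sup>2)"
    and i4: "integrable lborel (\<lambda>t. indicator {-pi..pi} t * ?S t ^ 4)"
    and ip: "integrable lborel (\<lambda>t. indicator {-pi..pi} t * ?S t powr p)"
    and i0: "integrable lborel (\<lambda>t. indicator {-pi..pi} t * (1::real))"
    by (intro int continuous_intros cS continuous_on_powr'; use p in auto)+
  define Ip where "Ip = (LINT t|lborel. indicator {-pi..pi} t * ?S t powr p)"
  \<comment> \<open>The right side of \<open>square_le_powr_plus\<close> with the normalisation by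
    \<open>sqrt N\<close> expanded, restricted to one period.\<close>
  let ?R = "\<lambda>t. 8 * 2 powr p / real N powr (p / 2) * (indicator {-pi..pi} t * ?S t powr p)
      + 1/4 * (indicator {-pi..pi} t * (1::real)) + 1 / (8 * (real N)\<^sup>2) * (indicator {-pi..pi} t * ?S t ^ 4)"
  have "2 * pi = (LINT t|lborel. 1 / real N * (indicator {-pi..pi} t * (?S t)\<^sup>2))"
    using lacunary_trig_L2[of N] N by simp
  also have "\<dots> \<le> (LINT t|lborel. ?R t)"
  proof (rule integral_mono)
    show "integrable lborel (\<lambda>t. 1 / real N * (indicator {-pi..pi} t * (?S t)\<^sup>2))"
      by (intro integrable_mult_right i2)
    show "integrable lborel ?R"
      by (intro Bochner_Integration.integrable_add integrable_mult_right ip i0 i4)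
    fix t :: real
    define u where "u = ?S t / sqrt (real N)"
    have u2: "u\<^sup>2 = (?S t)\<^sup>2 / real N" by (simp add: u_def power_divide)
    have u4: "u ^ 4 = ?S t ^ 4 / (real N)\<^sup>2"
    proof -
      have "u ^ 4 = (u\<^sup>2)\<^sup>2" by (simp flip: power_mult)
      then show ?thesis unfolding u2 by (simp add: power_divide flip: power_mult)
    qed
    have up: "u powr p = ?S t powr p / real N powr (p / 2)"
      using N by (simp add: u_def powr_divide powr_half_sqrt[symmetric] powr_powr)
    have "u\<^sup>2 \<le> 8 * 2 powr p * u powr p + 1/4 + u ^ 4 / 8"
      by (rule square_le_powr_plus) (auto simp: u_def p)
    then show "1 / real N * (indicator {-pi..pi} t * (?S t)\<^sup>2) \<le> ?R t"
      unfolding u2 u4 up by (auto simp: indicator_def)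
  qed
  also have "\<dots> = 8 * 2 powr p / real N powr (p / 2) * Ip + 1/4 * (2 * pi)
      + 1 / (8 * (real N)\<^sup>2) * (LINT t|lborel. indicator {-pi..pi} t * ?S t ^ 4)"
    using ip i0 i4 by (simp add: Ip_def)
  also have "\<dots> \<le> 8 * 2 powr p / real N powr (p / 2) * Ip + 1/4 * (2 * pi)
      + 1 / (8 * (real N)\<^sup>2) * (4 * pi * (real N)\<^sup>2)"
    by (intro add_left_mono mult_left_mono lacunary_trig_L4) auto
  also have "\<dots> = 8 * 2 powr p / real N powr (p / 2) * Ip + pi"
    using N by simp
  finally have "pi \<le> 8 * 2 powr p / real N powr (p / 2) * Ip" by simp
  then show ?thesis using N by (simp add: Ip_def field_simps)
qed

lemma lacunary_sum_unshifted: "lacunary_sum K N (\<lambda>_. 0) t = complex_of_real (wave K t) * lacunary_trig N t"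
  by (simp add: lacunary_sum_def lacunary_trig_def wave_packet_def sum_distrib_left)

text \<open>Without shifts the wave is a common factor, bounded below by \<open>c\<close> on one
  full period; the integral is restricted to that period.\<close>

lemma lacunary_sum_lower_bound_sqrt:
  assumes p: "0 < p" and K: "2 \<le> K"
  obtains \<delta> where "0 < \<delta>" "\<And>N. 1 \<le> N \<Longrightarrow> ennreal (\<delta> * real N powr (p / 2))
    \<le> (\<integral>\<^sup>+ t. ennreal (norm (lacunary_sum K N (\<lambda>_. 0) t) powr p) \<partial>lborel)"
proof -
  obtain c where c: "0 < c" "\<And>t. t \<in> {-pi..pi} \<Longrightarrow> c \<le> wave K t"
    using wave_lower_bound[OF K] by blast
  show thesis
  proof (rule that[of "c powr p * (pi / (8 * 2 powr p))"])
    fix N :: nat assume N: "1 \<le> N"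
    let ?S = "\<lambda>t. norm (lacunary_trig N t)"
    have "continuous_on {-pi..pi} (\<lambda>t. ?S t powr p)"
      using p by (intro continuous_on_powr' continuous_intros continuous_on_lacunary_trig) auto
    from borel_integrable_compact[OF compact_Icc this]
    have int: "integrable lborel (\<lambda>t. indicator {-pi..pi} t * ?S t powr p)"
      by simp
    have "ennreal (c powr p * (pi / (8 * 2 powr p)) * real N powr (p / 2))
        \<le> ennreal (c powr p * (LINT t|lborel. indicator {-pi..pi} t * ?S t powr p))"
      using lacunary_trig_Lp[OF p N] unfolding mult.assoc by (intro ennreal_leI mult_left_mono) auto
    also have "\<dots> = ennreal (LINT t|lborel. c powr p * (indicator {-pi..pi} t * ?S t powr p))"
      by simp
    also have "\<dots> = (\<integral>\<^sup>+ t. ennreal (c powr p * (indicator {-pi..pi} t * ?S t powr p)) \<partial>lborel)"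
      by (rule nn_integral_eq_integral[symmetric]) (use int in auto)
    also have "\<dots> \<le> (\<integral>\<^sup>+ t. ennreal (norm (lacunary_sum K N (\<lambda>_. 0) t) powr p) \<partial>lborel)"
    proof (intro nn_integral_mono ennreal_leI)
      fix t :: real
      show "c powr p * (indicator {-pi..pi} t * ?S t powr p) \<le> norm (lacunary_sum K N (\<lambda>_. 0) t) powr p"
      proof (cases "t \<in> {-pi..pi}")
        case True
        have "c powr p * ?S t powr p = (c * ?S t) powr p"
          using c by (simp add: powr_mult)
        also have "\<dots> \<le> (\<bar>wave K t\<bar> * ?S t) powr p"
          using c(1) c(2)[OF True] p by (intro powr_mono2 mult_right_mono) auto
        finally show ?thesis using True by (simp add: lacunary_sum_unshifted norm_mult)
      qed simp
    qed
    finally show "ennreal (c powr p * (pi / (8 * 2 powr p)) * real N powr (p / 2))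
        \<le> (\<integral>\<^sup>+ t. ennreal (norm (lacunary_sum K N (\<lambda>_. 0) t) powr p) \<partial>lborel)" .
  qed (use c in auto)
qed

text \<open>Shifts far enough apart decouple the summands, uniformly in their number.\<close>

lemma lacunary_sum_lower_bound_linear:
  assumes p: "0 < p" and K: "2 \<le> K"
  obtains \<delta> where "0 < \<delta>" "\<And>N. 1 \<le> N \<Longrightarrow> \<exists>s. ennreal (\<delta> * real N)
    \<le> (\<integral>\<^sup>+ t. ennreal (norm (lacunary_sum K N s t) powr p) \<partial>lborel)"
proof -
  obtain c where c: "0 < c" "\<And>t. t \<in> {-pi..pi} \<Longrightarrow> c \<le> wave K t"
    using wave_lower_bound[OF K] by blast
  show thesis
  proof (rule that[of "(c / 2) powr p * (2 * pi)"])
    fix N :: nat assume N: "1 \<le> N"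
    \<comment> \<open>The part \<open>3 * pi\<close> exceeds the interval length
      \<open>2 * pi\<close>, giving disjointness, and covers the loss of \<open>pi\<close> when
      \<open>s l\<close> is replaced by \<open>t\<close>. The second part makes each foreign packet
      at most \<open>c / (2 * N)\<close>, so that together they cost at most half of
      \<open>c\<close>.\<close>
    define L where "L = 3 * pi + 4 * (real K)\<^sup>2 * real N / c"
    define s where "s l = real l * L" for l :: nat
    let ?I = "\<lambda>l. {s l - pi..s l + pi}"
    have pos: "0 \<le> 4 * (real K)\<^sup>2 * real N / c" using c by simp
    have sep: "L \<le> \<bar>s l - s m\<bar>" if "l \<noteq> m" for l m
    proof -
      have "1 \<le> \<bar>real l - real m\<bar>" using that by linarith
      then have "1 * L \<le> \<bar>real l - real m\<bar> * L" using pos pi_gt_zero by (intro mult_right_mono) (auto simp: L_def)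
      also have "\<dots> = \<bar>s l - s m\<bar>" using pos pi_gt_zero
        by (simp add: s_def L_def abs_mult flip: left_diff_distrib)
      finally show ?thesis by simp
    qed
    have disj: "disjoint_family_on ?I {1..N}"
      unfolding disjoint_family_on_def
    proof (intro ballI impI)
      fix l m :: nat assume "l \<noteq> m"
      then have "3 * pi \<le> \<bar>s l - s m\<bar>" using sep[of l m] pos by (simp add: L_def)
      moreover have "\<bar>s l - s m\<bar> \<le> 2 * pi" if "t \<in> ?I l \<inter> ?I m" for t
        using that by (auto simp: abs_le_iff)
      ultimately show "?I l \<inter> ?I m = {}" using pi_gt_zero by fastforce
    qed
    have low: "c / 2 \<le> norm (lacunary_sum K N s t)" if l: "l \<in> {1..N}" and t: "t \<in> ?I l" for l t
    proof -
      have tail: "\<bar>wave K (t - s m)\<bar> \<le> c / (2 * real N)" if "m \<in> {1..N} - {l}" for m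
      proof -
        define u where "u = \<bar>t - s m\<bar>"
        have "L \<le> \<bar>s l - s m\<bar>" using that sep[of l m] by auto
        then have u: "1 + 4 * (real K)\<^sup>2 * real N / c \<le> u"
          using t pi_gt3 unfolding L_def u_def by auto
        then have u1: "1 \<le> u" using pos by linarith
        have "\<bar>wave K (t - s m)\<bar> \<le> 2 * (real K)\<^sup>2 / (1 + u\<^sup>2)"
          using abs_wave_bound[OF K, of "t - s m"] by (simp add: u_def)
        \<comment> \<open>First-order decay is enough here, since the separation may grow with
          \<open>N\<close>.\<close>
        also have "\<dots> \<le> 2 * (real K)\<^sup>2 / u"
        proof (rule divide_left_mono)
          have "u * 1 \<le> u * u" using u1 by (intro mult_left_mono) auto
          then show "u \<le> 1 + u\<^sup>2" by (simp add: power2_eq_square)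
        qed (use u1 in \<open>auto intro!: mult_pos_pos add_pos_nonneg\<close>)
        also have "\<dots> \<le> 2 * (real K)\<^sup>2 / (4 * (real K)\<^sup>2 * real N / c)"
          using u u1 N K c by (intro divide_left_mono) (auto intro!: mult_pos_pos divide_pos_pos)
        also have "\<dots> = c / (2 * real N)"
          using K N c by (simp add: field_simps)
        finally show ?thesis .
      qed
      have "c \<le> \<bar>wave K (t - s l)\<bar>"
        using c(2)[of "t - s l"] t by auto
      moreover have "norm (\<Sum>m\<in>{1..N} - {l}. wave_packet K (s m) (7 * 2 ^ m) t) \<le> c / 2"
      proof -
        have "norm (\<Sum>m\<in>{1..N} - {l}. wave_packet K (s m) (7 * 2 ^ m) t)
            \<le> (\<Sum>m\<in>{1..N} - {l}. c / (2 * real N))"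
          by (rule sum_norm_le) (use tail in \<open>simp add: norm_wave_packet\<close>)
        also have "\<dots> = (real N - 1) * (c / (2 * real N))"
          using l N by (simp add: of_nat_diff)
        also have "\<dots> \<le> real N * (c / (2 * real N))"
          using c by (intro mult_right_mono) auto
        also have "\<dots> = c / 2" using N by simp
        finally show ?thesis .
      qed
      moreover have "lacunary_sum K N s t = wave_packet K (s l) (7 * 2 ^ l) t
          + (\<Sum>m\<in>{1..N} - {l}. wave_packet K (s m) (7 * 2 ^ m) t)"
        unfolding lacunary_sum_def by (rule sum.remove) (use l in auto)
      moreover have "norm (wave_packet K (s l) (7 * 2 ^ l) t) = \<bar>wave K (t - s l)\<bar>"
        by (rule norm_wave_packet)
      ultimately show ?thesis
        using norm_diff_ineq[of "wave_packet K (s l) (7 * 2 ^ l) t" "\<Sum>m\<in>{1..N} - {l}. wave_packet K (s m) (7 * 2 ^ m) t"]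
        by simp
    qed
    have "ennreal ((c / 2) powr p * (2 * pi) * real N) = (\<Sum>l\<in>{1..N}. ennreal ((c / 2) powr p * (2 * pi)))"
      using c by (simp add: ennreal_mult ennreal_of_nat_eq_real_of_nat mult_ac)
    also have "\<dots> = (\<Sum>l\<in>{1..N}. (\<integral>\<^sup>+ t. ennreal ((c / 2) powr p) * indicator (?I l) t \<partial>lborel))"
      by (subst nn_integral_cmult_indicator) (auto simp: ennreal_mult)
    also have "\<dots> = (\<integral>\<^sup>+ t. (\<Sum>l\<in>{1..N}. ennreal ((c / 2) powr p) * indicator (?I l) t) \<partial>lborel)"
      by (rule nn_integral_sum[symmetric]) auto
    also have "\<dots> \<le> (\<integral>\<^sup>+ t. ennreal (norm (lacunary_sum K N s t) powr p) \<partial>lborel)"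
    proof (rule nn_integral_mono)
      fix t :: real
      show "(\<Sum>l\<in>{1..N}. ennreal ((c / 2) powr p) * indicator (?I l) t) \<le> ennreal (norm (lacunary_sum K N s t) powr p)"
      proof (cases "\<exists>l\<in>{1..N}. t \<in> ?I l")
        case True
        then obtain l where l: "l \<in> {1..N}" "t \<in> ?I l" by blast
        have "t \<notin> ?I m" if "m \<in> {1..N} - {l}" for m
          using disj l that unfolding disjoint_family_on_def by blast
        then have "(\<Sum>m\<in>{1..N} - {l}. ennreal ((c / 2) powr p) * indicator (?I m) t) = 0"
          by (intro sum.neutral) auto
        then have "(\<Sum>l\<in>{1..N}. ennreal ((c / 2) powr p) * indicator (?I l) t) = ennreal ((c / 2) powr p)"
          using l by (subst sum.remove[of _ l]) auto
        also have "\<dots> \<le> ennreal (norm (lacunary_sum K N s t) powr p)"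
          using low[OF l] c(1) p by (intro ennreal_leI powr_mono2) auto
        finally show ?thesis .
      next
        case False
        then have "(\<Sum>l\<in>{1..N}. ennreal ((c / 2) powr p) * indicator (?I l) t) = 0"
          by (intro sum.neutral) auto
        then show ?thesis by (simp only: zero_le)
      qed
    qed
    finally show "\<exists>s. ennreal ((c / 2) powr p * (2 * pi) * real N)
        \<le> (\<integral>\<^sup>+ t. ennreal (norm (lacunary_sum K N s t) powr p) \<partial>lborel)" by blast
  qed (use c in auto)
qed

theorem lemma4p10:
  fixes \<psi>0 :: "real^'n::finite \<Rightarrow> real" and \<phi>0 :: "real \<Rightarrow> real"
    and p q :: ennreal
  assumes "CARD('n) \<ge> 2"
    and "psi0_admissible \<psi>0" and "phi0_admissible \<phi>0"
    and "0 < p" and "0 < q"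
    and "mixed_embeds_besov \<phi>0 \<psi>0 0 p q"
  shows "(p \<noteq> top \<longrightarrow> q \<le> min 2 p) \<and> (p = top \<longrightarrow> q \<le> 1)"
proof -
  obtain a b :: 'n where ab: "a \<noteq> b"
    using assms(1) card_le_Suc0_iff_eq[of "UNIV :: 'n set"] by fastforce
  \<comment> \<open>For \<open>q = top\<close>, \<open>1 / enn2real q\<close> is 0, which
    contradicts the premise because \<open>x\<close> is positive.\<close>
  have q_le: "q \<le> ennreal x" if "1 / x \<le> 1 / enn2real q" "0 < x" for x
  proof (cases q)
    case (real r)
    with that assms(5) show ?thesis
      by (cases "r = 0") (auto simp: field_simps intro!: ennreal_leI)
  next
    case top
    with that show ?thesis by (simp add: field_simps)
  qed
  have "q \<le> 1" if p: "p = top"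
  proof -
    \<comment> \<open>For infinite \<open>p\<close> no integrability of powers is at stake, so the
      smallest admissible \<open>K = 2\<close> is taken.\<close>
    have "Lp_norm p (packet 2 a b N s l) \<le> ennreal 1" for N s l
      unfolding p
    proof (rule Lp_norm_top_le)
      show "packet 2 a b N s l \<in> borel_measurable borel"
        unfolding packet_def[abs_def] by measurable
      show "norm (packet 2 a b N s l x) \<le> 1" for x
        unfolding norm_packet by (intro prod_le_1) (auto simp: abs_wave_le)
    qed
    from embedding_packet_sum_bound[OF assms(2,3,5,6) order_refl ab zero_le_one this]
    obtain C where C: "0 \<le> C" "\<And>N s. 1 \<le> N \<Longrightarrow>
        Lp_norm p (packet_sum 2 a b N s) \<le> ennreal (C * real N powr (1 / enn2real q))"
      by blast
    have "1 * real N powr 1 \<le> C * real N powr (1 / enn2real q)" if N: "1 \<le> N" for N :: nat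
    proof -
      \<comment> \<open>Every unshifted packet equals 1 at the origin, so the phases align
        there.\<close>
      have "packet_sum 2 a b N (\<lambda>_. 0) 0 = of_nat N"
        by (simp add: packet_sum_def packet_def wave_packet_def)
      then have "ennreal (real N) \<le> Lp_norm p (packet_sum 2 a b N (\<lambda>_. 0))"
        using Lp_norm_top_ge[OF continuous_on_packet_sum[of 2 a b N "\<lambda>_. 0"], of 0] p by simp
      also have "\<dots> \<le> ennreal (C * real N powr (1 / enn2real q))"
        by (rule C(2)[OF N])
      finally show ?thesis using C(1) by simp
    qed
    then have "1 \<le> 1 / enn2real q"
      by (rule powr_growth_le[rotated]) auto
    with q_le[of 1] show ?thesis by simp
  qed
  moreover have "q \<le> min 2 p" if p: "p \<noteq> top"
  proof -
    define r where "r = enn2real p"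
    have r: "0 < r" using assms(4) p by (simp add: r_def enn2real_positive_iff less_top)
    \<comment> \<open>The second condition makes the p-th power of the wave integrable, however
      small \<open>p\<close> is.\<close>
    obtain K :: nat where K: "2 \<le> K" "2 \<le> real K * r"
    proof -
      obtain K :: nat where "max 2 (2 / r) \<le> real K" using real_arch_simple by blast
      then have "2 \<le> K" "2 \<le> real K * r" using r by (auto simp: field_simps)
      then show thesis by (rule that)
    qed
    from embedding_lacunary_sum_bound[OF assms(2,3,5,6,4) p K[unfolded r_def] ab]
    obtain C where C: "0 \<le> C" "\<And>N s. 1 \<le> N \<Longrightarrow>
        (\<integral>\<^sup>+ t. ennreal (norm (lacunary_sum K N s t) powr r) \<partial>lborel)
          \<le> ennreal (C * real N powr (r / enn2real q))"
      unfolding r_def by blast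
    obtain \<delta> where \<delta>: "0 < \<delta>" "\<And>N. 1 \<le> N \<Longrightarrow> ennreal (\<delta> * real N powr (r / 2))
        \<le> (\<integral>\<^sup>+ t. ennreal (norm (lacunary_sum K N (\<lambda>_. 0) t) powr r) \<partial>lborel)"
      using lacunary_sum_lower_bound_sqrt[OF r K(1)] by blast
    have "\<delta> * real N powr (r / 2) \<le> C * real N powr (r / enn2real q)" if "1 \<le> N" for N :: nat
      using order_trans[OF \<delta>(2)[OF that] C(2)[OF that]] C(1) by simp
    then have "r / 2 \<le> r / enn2real q"
      by (rule powr_growth_le[OF \<delta>(1)])
    then have "1 / 2 \<le> 1 / enn2real q"
      using r mult_le_cancel_left_pos[of r "1 / 2" "1 / enn2real q"] by simp
    then have "q \<le> ennreal 2" by (rule q_le) simp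
    moreover
    obtain \<eta> where \<eta>: "0 < \<eta>" "\<And>N. 1 \<le> N \<Longrightarrow> \<exists>s. ennreal (\<eta> * real N)
        \<le> (\<integral>\<^sup>+ t. ennreal (norm (lacunary_sum K N s t) powr r) \<partial>lborel)"
      using lacunary_sum_lower_bound_linear[OF r K(1)] by blast
    have "\<eta> * real N powr 1 \<le> C * real N powr (r / enn2real q)" if N: "1 \<le> N" for N :: nat
    proof -
      obtain s where "ennreal (\<eta> * real N)
        \<le> (\<integral>\<^sup>+ t. ennreal (norm (lacunary_sum K N s t) powr r) \<partial>lborel)"
        using \<eta>(2)[OF N] by blast
      from order_trans[OF this C(2)[OF N]] C(1) show ?thesis by simp
    qed
    then have "1 \<le> r / enn2real q"
      by (rule powr_growth_le[OF \<eta>(1)])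
    then have "1 / r \<le> 1 / enn2real q"
      using r mult_le_cancel_left_pos[of r "1 / r" "1 / enn2real q"] by simp
    then have "q \<le> ennreal r" by (rule q_le) (rule r)
    then have "q \<le> p" using p by (simp add: r_def less_top)
    ultimately show ?thesis by simp
  qed
  ultimately show ?thesis by blast
qed

end
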